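(* Let $F(w)=\frac1n\sum_{i=1}^n f(w;\zeta_i)$ be $c$-weak convex ($c>0$) with $G$-bounded stochastic gradient, and let stagewise M-DSGD (described in the context) be run with $\gamma=1/(2c)$, momentum $\beta\in[0,1)$, stage learning rates $\eta_s=\eta_0/(s+1)$ and stage lengths $T_s$ with $\eta_sT_s\ge 12\gamma$, producing stage points $\tilde w_s$ and inner sequences $\{w_{s,t}\},\{\tilde u_{s,t}\}$. Assume there are constants $B,U,M$ such that $\mathbb{E}\|w_{s,t}-w^*\|^2\le B^2$, $\mathbb{E}\|\tilde u_{s,t}\|^2\le U^2$ and $\mathbb{E}F(\tilde w_s)\le M$ for all $s,t$. Then $$\frac{(1+\beta)\gamma}{4S(S+1)}\sum_{s=0}^{S-1}(s+1)\,\mathbb{E}\|\nabla F_\gamma(\tilde w_s)\|^2\le\frac{M-F(w^* )+3\hat C\eta_0}{S+1},$$ where $F_\gamma(w)=\min_{w'}\left\{F(w')+\frac{1}{2\gamma}\|w-w'\|^2\right\}$, $\hat C=\hat G\sqrt{2\hat G^2\beta^2/(1-\beta)^4+2U^2}+\hat G^2/(2-2\beta)$ and $\hat G=\sqrt{2G^2+4B^2/\gamma^2}$.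
   Context: $\|\cdot\|$ is the Euclidean norm; $w\in\mathbb{R}^d$, $\zeta_1,\dots,\zeta_n$ are the training data, and $w^*$ is a minimizer of $F$. No smoothness of $F$ or $f(\cdot;\zeta_i)$ is assumed. Throughout, $\mathbb{E}_{\zeta_i}\|\nabla f(w;\zeta_i)\|^2\le G^2$ for all $w$. M-DSGD with constant learning rate, $\mathcal{A}(\phi,\tilde w,\eta,\beta,T)$, for a function $\phi(w)=\frac1n\sum_{i=1}^n\varphi(w;\zeta_i)$: there are $p$ workers and a batch size $b$. Start from $w_0=\tilde w$, $g_{-1,k}=u_{0,k}=0$ ($k=1,\dots,p$). For $t=0,\dots,T-1$ each worker $k$ randomly picks a mini-batch $\mathcal{I}_{t,k}$ of $b$ training samples and a vector $m_{t,k}\in\{0,1\}^d$, and with $\odot$ the coordinatewise product and $\mathbf 1=(1,\dots,1)^T$, $$g_{t,k}=\beta g_{t-1,k}+\frac{1}{pb}\sum_{\zeta_i\in\mathcal{I}_{t,k}}\nabla\varphi(w_t;\zeta_i),\quad u_{t+1,k}=(\mathbf 1-m_{t,k})\odot(g_{t,k}+u_{t,k}),\quad w_{t+1}=w_t-\eta\sum_{k=1}^p m_{t,k}\odot(g_{t,k}+u_{t,k}).$$ Write $\tilde u_t=\sum_k u_{t,k}$, $\tilde g_t=\sum_k g_{t,k}$ (so $w_{t+1}-\eta\tilde u_{t+1}=w_t-\eta(\tilde g_t+\tilde u_t)$). The aggregated mini-batch gradient $\frac{1}{pb}\sum_k\sum_{\zeta_i\in\mathcal{I}_{t,k}}\nabla\varphi(w_t;\zeta_i)$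 is, conditionally on $w_t$, an unbiased estimate of $\nabla\phi(w_t)$. The output of $\mathcal{A}$ is the average $\frac1T\sum_{t=0}^{T-1}w_t$. Stagewise M-DSGD: starting from $\tilde w_0$, for $s=0,1,2,\dots$ set $$\tilde w_{s+1}=\mathcal{A}(F_{s,\gamma},\tilde w_s,\eta_s,\beta,T_s),\qquad F_{s,\gamma}(w)=F(w)+\frac{1}{2\gamma}\|w-\tilde w_s\|^2,$$ i.e. $\varphi(w;\zeta_i)=f(w;\zeta_i)+\frac{1}{2\gamma}\|w-\tilde w_s\|^2$; $\{w_{s,t}\}_t$ and $\{\tilde u_{s,t}\}_t$ denote the sequences $\{w_t\},\{\tilde u_t\}$ produced inside stage $s$. $F$ has $G$-bounded stochastic gradient ($G>0$) means that its stochastic gradient $g$ satisfies $\mathbb{E}[g\mid w]=\nabla F(w)$ and $\mathbb{E}\|g\|^2\le G^2$ for all $w$. $F$ is $c$-weak convex if $F(w)\ge F(w')+\nabla F(w')^T(w-w')-\frac{c}{2}\|w-w'\|^2$ for all $w,w'$. *)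

theory Defs
  imports "HOL-Probability.Probability"
begin

section \<open>Gradients, weak convexity, Moreau envelope\<close>

definition grad :: "(real^'d \<Rightarrow> real) \<Rightarrow> real^'d \<Rightarrow> real^'d"
  where "grad f x = (THE v. GDERIV f x :> v)"

text \<open>
  The functions need not be differentiable everywhere.  The symbol \<open>\<nabla>f\<close> of the training losses is
  therefore a vector field that is the gradient wherever the gradient exists and is otherwise some
  chosen generalised gradient.
\<close>

definition gradient_selection :: "(real^'d \<Rightarrow> real) \<Rightarrow> (real^'d \<Rightarrow> real^'d) \<Rightarrow> bool"
  where "gradient_selection f f' \<longleftrightarrow> (\<forall>x v. GDERIV f x :> v \<longrightarrow> f' x = v)"

text \<open>
  The inequality forces \<open>F' x\<close> to be the gradient of \<open>F\<close> at every point \<open>x\<close> of differentiability.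
\<close>

definition weak_convex :: "real \<Rightarrow> (real^'d \<Rightarrow> real) \<Rightarrow> (real^'d \<Rightarrow> real^'d) \<Rightarrow> bool"
  where "weak_convex c F F' \<longleftrightarrow>
    (\<forall>w w'. F w \<ge> F w' + F' w' \<bullet> (w - w') - c / 2 * (norm (w - w'))\<^sup>2)"

text \<open>
  Defined by an infimum; it is a minimum when \<open>F\<close> is \<open>c\<close>-weak convex and \<open>\<gamma> < 1 / c\<close>.
\<close>

definition moreau_envelope :: "real \<Rightarrow> (real^'d \<Rightarrow> real) \<Rightarrow> real^'d \<Rightarrow> real"
  where "moreau_envelope \<gamma> F w = (INF w'. F w' + 1 / (2 * \<gamma>) * (norm (w - w'))\<^sup>2)"

section \<open>M-DSGD along a sample path\<close>

text \<open>
  \<open>dphi i w\<close> stands for \<open>\<nabla>\<phi>(w; \<zeta>\<^sub>i)\<close>, with the training data indexed by \<open>{1..n}\<close> and the workers by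
  \<open>{1..p}\<close>.  A mini-batch is a multiset of indices, so that sampling with and without replacement
  are both covered.
\<close>

definition worker_grad ::
    "nat \<Rightarrow> nat \<Rightarrow> (nat \<Rightarrow> real^'d \<Rightarrow> real^'d) \<Rightarrow> nat multiset \<Rightarrow> real^'d \<Rightarrow> real^'d"
  where "worker_grad p b dphi I w = (1 / (real p * real b)) *\<^sub>R (\<Sum>i\<in>#I. dphi i w)"

definition aggregated_grad ::
    "nat \<Rightarrow> nat \<Rightarrow> (nat \<Rightarrow> real^'d \<Rightarrow> real^'d) \<Rightarrow> (nat \<Rightarrow> nat multiset) \<Rightarrow> real^'d \<Rightarrow> real^'d"
  where "aggregated_grad p b dphi I w = (\<Sum>k=1..p. worker_grad p b dphi (I k) w)"

text \<open>
  The state at time \<open>t\<close> is \<open>(w\<^sub>t, \<lambda>k. g\<^bsub>t-1,k\<^esub>, \<lambda>k. u\<^bsub>t,k\<^esub>)\<close>; the momentum index is shifted by one.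
  The product of two vectors is the coordinatewise one, and \<open>1\<close> is the all-ones vector.
\<close>

primrec mdsgd_state ::
    "nat \<Rightarrow> nat \<Rightarrow> (nat \<Rightarrow> real^'d \<Rightarrow> real^'d) \<Rightarrow> real^'d \<Rightarrow> real \<Rightarrow> real
      \<Rightarrow> (nat \<Rightarrow> nat \<Rightarrow> nat multiset) \<Rightarrow> (nat \<Rightarrow> nat \<Rightarrow> real^'d)
      \<Rightarrow> nat \<Rightarrow> (real^'d) \<times> (nat \<Rightarrow> real^'d) \<times> (nat \<Rightarrow> real^'d)"
  where
    "mdsgd_state p b dphi v \<eta> \<beta> I m 0 = (v, \<lambda>_. 0, \<lambda>_. 0)"
  | "mdsgd_state p b dphi v \<eta> \<beta> I m (Suc t) =
      (let (w, g, u) = mdsgd_state p b dphi v \<eta> \<beta> I m t;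
           g' = (\<lambda>k. \<beta> *\<^sub>R g k + worker_grad p b dphi (I t k) w)
       in (w - \<eta> *\<^sub>R (\<Sum>k=1..p. m t k * (g' k + u k)),
           g',
           \<lambda>k. (1 - m t k) * (g' k + u k)))"

definition mdsgd_output ::
    "nat \<Rightarrow> nat \<Rightarrow> (nat \<Rightarrow> real^'d \<Rightarrow> real^'d) \<Rightarrow> real^'d \<Rightarrow> real \<Rightarrow> real \<Rightarrow> nat
      \<Rightarrow> (nat \<Rightarrow> nat \<Rightarrow> nat multiset) \<Rightarrow> (nat \<Rightarrow> nat \<Rightarrow> real^'d) \<Rightarrow> real^'d"
  where "mdsgd_output p b dphi v \<eta> \<beta> T I m =
    (1 / real T) *\<^sub>R (\<Sum>t<T. fst (mdsgd_state p b dphi v \<eta> \<beta> I m t))"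

section \<open>Stagewise M-DSGD along a sample path\<close>

text \<open>Gradients of the regularised losses \<open>f(w; \<zeta>\<^sub>i) + 1 / (2 \<gamma>) \<parallel>w - v\<parallel>\<^sup>2\<close>.\<close>

definition regularised_grad ::
    "real \<Rightarrow> (nat \<Rightarrow> real^'d \<Rightarrow> real^'d) \<Rightarrow> real^'d \<Rightarrow> nat \<Rightarrow> real^'d \<Rightarrow> real^'d"
  where "regularised_grad \<gamma> df v i w = df i w + (1 / \<gamma>) *\<^sub>R (w - v)"

text \<open>In \<open>I s t k\<close> and \<open>m s t k\<close> the arguments are the stage, the iteration and the worker.\<close>

primrec stage_point ::
    "nat \<Rightarrow> nat \<Rightarrow> (nat \<Rightarrow> real^'d \<Rightarrow> real^'d) \<Rightarrow> real \<Rightarrow> real^'d \<Rightarrow> (nat \<Rightarrow> real) \<Rightarrow> real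
      \<Rightarrow> (nat \<Rightarrow> nat) \<Rightarrow> (nat \<Rightarrow> nat \<Rightarrow> nat \<Rightarrow> nat multiset)
      \<Rightarrow> (nat \<Rightarrow> nat \<Rightarrow> nat \<Rightarrow> real^'d) \<Rightarrow> nat \<Rightarrow> real^'d"
  where
    "stage_point p b df \<gamma> v \<eta> \<beta> T I m 0 = v"
  | "stage_point p b df \<gamma> v \<eta> \<beta> T I m (Suc s) =
      (let x = stage_point p b df \<gamma> v \<eta> \<beta> T I m s
       in mdsgd_output p b (regularised_grad \<gamma> df x) x (\<eta> s) \<beta> (T s) (I s) (m s))"

definition stage_state ::
    "nat \<Rightarrow> nat \<Rightarrow> (nat \<Rightarrow> real^'d \<Rightarrow> real^'d) \<Rightarrow> real \<Rightarrow> real^'d \<Rightarrow> (nat \<Rightarrow> real) \<Rightarrow> real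
      \<Rightarrow> (nat \<Rightarrow> nat) \<Rightarrow> (nat \<Rightarrow> nat \<Rightarrow> nat \<Rightarrow> nat multiset)
      \<Rightarrow> (nat \<Rightarrow> nat \<Rightarrow> nat \<Rightarrow> real^'d)
      \<Rightarrow> nat \<Rightarrow> nat \<Rightarrow> (real^'d) \<times> (nat \<Rightarrow> real^'d) \<times> (nat \<Rightarrow> real^'d)"
  where "stage_state p b df \<gamma> v \<eta> \<beta> T I m s t =
    (let x = stage_point p b df \<gamma> v \<eta> \<beta> T I m s
     in mdsgd_state p b (regularised_grad \<gamma> df x) x (\<eta> s) \<beta> (I s) (m s) t)"

definition stage_iterate ::
    "nat \<Rightarrow> nat \<Rightarrow> (nat \<Rightarrow> real^'d \<Rightarrow> real^'d) \<Rightarrow> real \<Rightarrow> real^'d \<Rightarrow> (nat \<Rightarrow> real) \<Rightarrow> real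
      \<Rightarrow> (nat \<Rightarrow> nat) \<Rightarrow> (nat \<Rightarrow> nat \<Rightarrow> nat \<Rightarrow> nat multiset)
      \<Rightarrow> (nat \<Rightarrow> nat \<Rightarrow> nat \<Rightarrow> real^'d) \<Rightarrow> nat \<Rightarrow> nat \<Rightarrow> real^'d"
  where "stage_iterate p b df \<gamma> v \<eta> \<beta> T I m s t =
    fst (stage_state p b df \<gamma> v \<eta> \<beta> T I m s t)"

definition stage_memory ::
    "nat \<Rightarrow> nat \<Rightarrow> (nat \<Rightarrow> real^'d \<Rightarrow> real^'d) \<Rightarrow> real \<Rightarrow> real^'d \<Rightarrow> (nat \<Rightarrow> real) \<Rightarrow> real
      \<Rightarrow> (nat \<Rightarrow> nat) \<Rightarrow> (nat \<Rightarrow> nat \<Rightarrow> nat \<Rightarrow> nat multiset)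
      \<Rightarrow> (nat \<Rightarrow> nat \<Rightarrow> nat \<Rightarrow> real^'d) \<Rightarrow> nat \<Rightarrow> nat \<Rightarrow> real^'d"
  where "stage_memory p b df \<gamma> v \<eta> \<beta> T I m s t =
    (\<Sum>k=1..p. snd (snd (stage_state p b df \<gamma> v \<eta> \<beta> T I m s t)) k)"

section \<open>Expectations\<close>

text \<open>The Bochner integral of a non-integrable function is 0, hence the integrability clause.\<close>

definition expectation_le :: "'s measure \<Rightarrow> ('s \<Rightarrow> real) \<Rightarrow> real \<Rightarrow> bool"
  where "expectation_le P X a \<longleftrightarrow> integrable P X \<and> (\<integral>\<omega>. X \<omega> \<partial>P) \<le> a"

text \<open>
  The random vector \<open>g\<close> is a stochastic gradient at the random point \<open>w\<close>, conditionally on the random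
  variable \<open>Z\<close>: \<open>E[g | \<sigma>(Z)] = F' w\<close> and \<open>E \<parallel>g\<parallel>\<^sup>2 \<le> G\<^sup>2\<close>.  Conditional expectations are
  real-valued in the library, hence the coordinates.
\<close>

definition bounded_stochastic_gradient ::
    "'s measure \<Rightarrow> real \<Rightarrow> (real^'d \<Rightarrow> real^'d) \<Rightarrow> ('s \<Rightarrow> 'z::topological_space)
      \<Rightarrow> ('s \<Rightarrow> real^'d) \<Rightarrow> ('s \<Rightarrow> real^'d) \<Rightarrow> bool"
  where "bounded_stochastic_gradient P G F' Z w g \<longleftrightarrow>
    (\<forall>j. AE \<omega> in P.
       real_cond_exp P (vimage_algebra (space P) Z borel) (\<lambda>\<omega>. g \<omega> $ j) \<omega> = F' (w \<omega>) $ j) \<and>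
    expectation_le P (\<lambda>\<omega>. (norm (g \<omega>))\<^sup>2) (G\<^sup>2)"

end

(*
  Along a sample path, z_t = w_t - eta u_t - eta beta/(1-beta) g_(t-1) performs plain stochastic
  gradient steps of length eta/(1-beta).  Expanding |z_t - y|^2 for the proximal point y of a stage
  point x bounds the expectation of Q, the average over t of <phi'(w_t), w_t - y>, where
  phi(w) = F(w) + c |w - x|^2.

  Let a be the average of the w_t, that is, the next stage point.  Strong convexity of phi gives
  phi(a) - phi(y) + c/2 |a - y|^2 <= Q as well as c |a - y|^2 <= Q.  Adding half of the second
  inequality to the first and using the parallelogram law yields F(a) + c |x - y|^2 <= F(x) + 3/2 Q.
  Since x - y is gamma times the gradient of the Moreau envelope at x, taking expectations gives
  descent in each stage, and the stages are added with the weights s + 1.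
*)
theory Submission
  imports Defs
begin

section \<open>Proximal points of weakly convex functions\<close>

text \<open>No differentiability is assumed, so optimality of y is never a vanishing gradient: only
  its minimality and the inequality of weak convexity at chosen points are available. With \<gamma>
  = 1/(2c) the quadratic has curvature 2c, weak convexity costs c, and the modulus of phi is exactly
  c.

  Conditioning needs care. The point y depends on the random x, so unbiasedness is taken
  conditionally on the pair (x, w_t); the prox map is Lipschitz, hence w_t - y is a measurable
  function of that pair. The delay w_t - z_t need not be one, so its product with the stochastic
  gradient is bounded by Cauchy-Schwarz instead.

  The constants fit together as follows. With D the expectation of |x - y|^2, the expectation of Q
  is at most (1-\<beta>)/(2 \<eta> T) D + 2 \<open>Chat\<close> \<eta>; the factor 3/2 turns the
  last term into 3 \<open>Chat\<close> \<eta>. The condition \<eta> T \<ge> 12 \<gamma> makes the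
  first term cost at most (1-\<beta>)/8 of c D, which leaves more than the required share
  (1+\<beta>)/2. The weights s + 1 make (s+1) \<eta>_s constant.\<close>

lemma norm_diff_sq_expand:
  fixes x y z :: "'a::real_inner"
  shows "(norm (x - z))\<^sup>2 = (norm (x - y))\<^sup>2 + 2 * ((y - x) \<bullet> (z - y)) + (norm (z - y))\<^sup>2"
  by (simp add: power2_norm_eq_inner inner_diff_left inner_diff_right inner_commute)

lemma norm_add_sq_le:
  fixes x y :: "'a::real_inner"
  shows "(norm (x + y))\<^sup>2 \<le> 2 * (norm x)\<^sup>2 + 2 * (norm y)\<^sup>2"
proof -
  have "(norm (x + y))\<^sup>2 + (norm (x - y))\<^sup>2 = 2 * (norm x)\<^sup>2 + 2 * (norm y)\<^sup>2"
    by (simp add: power2_norm_eq_inner inner_add_left inner_add_right inner_diff_left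
        inner_diff_right inner_commute)
  then show ?thesis using zero_le_power2[of "norm (x - y)"] by linarith
qed

lemma grad_eq: "grad f x = v" if "GDERIV f x :> v"
  unfolding grad_def
proof (rule the_equality[where P = "\<lambda>v. GDERIV f x :> v"])
  show "GDERIV f x :> v" by (rule that)
  fix v' assume "GDERIV f x :> v'"
  then have "(\<lambda>h. h \<bullet> v') = (\<lambda>h. h \<bullet> v)"
    using that unfolding gderiv_def by (rule has_derivative_unique)
  then show "v' = v"
    by (metis vector_eq_ldot inner_commute)
qed

text \<open>Weak convexity at \<open>x\<close> bounds \<open>F x - F y\<close> from above by a
  quantity vanishing with \<open>y - x\<close>, and a uniform bound on \<open>F'\<close> allows the
  roles of \<open>x\<close> and \<open>y\<close> to be exchanged. This supplies the continuity with
  which the proximal minimum is attained.\<close>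

lemma weak_convex_continuous:
  assumes "weak_convex c F F'" and K: "\<And>x. norm (F' x) \<le> K"
  shows "continuous_on UNIV F"
proof -
  have lower: "F x - F y \<le> K * norm (y - x) + \<bar>c\<bar> / 2 * (norm (y - x))\<^sup>2" for x y
  proof -
    have "F x + F' x \<bullet> (y - x) - c / 2 * (norm (y - x))\<^sup>2 \<le> F y"
      using assms(1) unfolding weak_convex_def by blast
    moreover have "- (F' x \<bullet> (y - x)) \<le> K * norm (y - x)"
      using Cauchy_Schwarz_ineq2[of "F' x" "y - x"] mult_right_mono[OF K[of x] norm_ge_zero[of "y - x"]]
      by linarith
    moreover have "c / 2 * (norm (y - x))\<^sup>2 \<le> \<bar>c\<bar> / 2 * (norm (y - x))\<^sup>2"
      by (intro mult_right_mono) auto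
    ultimately show ?thesis by linarith
  qed
  have "isCont F x" for x
  proof -
    have "((\<lambda>y. K * norm (y - x) + \<bar>c\<bar> / 2 * (norm (y - x))\<^sup>2)
        \<longlongrightarrow> K * norm (x - x) + \<bar>c\<bar> / 2 * (norm (x - x))\<^sup>2) (at x)"
      by (intro tendsto_intros)
    then have "((\<lambda>y. K * norm (y - x) + \<bar>c\<bar> / 2 * (norm (y - x))\<^sup>2) \<longlongrightarrow> 0) (at x)" by simp
    then have "((\<lambda>y. F y - F x) \<longlongrightarrow> 0) (at x)"
    proof (rule Lim_null_comparison[rotated], intro always_eventually allI)
      fix y show "norm (F y - F x) \<le> K * norm (y - x) + \<bar>c\<bar> / 2 * (norm (y - x))\<^sup>2"
        using lower[of x y] lower[of y x] by (simp add: abs_le_iff norm_minus_commute)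
    qed
    then show ?thesis by (simp add: isCont_def LIM_zero_iff)
  qed
  then show ?thesis by (simp add: continuous_at_imp_continuous_on)
qed

section \<open>The proximal map: existence, quadratic growth, Lipschitz continuity\<close>

definition prox_objective :: "real \<Rightarrow> (real^'d \<Rightarrow> real) \<Rightarrow> real^'d \<Rightarrow> real^'d \<Rightarrow> real"
  where "prox_objective \<gamma> F x w = F w + 1 / (2 * \<gamma>) * (norm (x - w))\<^sup>2"

definition prox :: "real \<Rightarrow> (real^'d \<Rightarrow> real) \<Rightarrow> real^'d \<Rightarrow> real^'d"
  where "prox \<gamma> F x = (SOME y. \<forall>z. prox_objective \<gamma> F x y \<le> prox_objective \<gamma> F x z)"

text \<open>The condition \<open>c * \<gamma> < 1\<close> is what makes the proximal objective
  strongly convex. The lower bound \<open>L\<close> serves the existence of proximal points; in the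
  theorem it is \<open>F wstar\<close>.\<close>

locale weakly_convex =
  fixes F :: "real^'d \<Rightarrow> real" and F' :: "real^'d \<Rightarrow> real^'d" and c \<gamma> L :: real
  assumes weakly_convex: "weak_convex c F F'"
    and continuous: "continuous_on UNIV F"
    and bounded_below: "L \<le> F w"
    and gamma_pos: "0 < \<gamma>"
    and gamma_less: "c * \<gamma> < 1"
begin

lemma modulus_pos: "0 < 1 / \<gamma> - c"
  using gamma_pos gamma_less by (simp add: field_simps)

text \<open>The expansion of the quadratic about \<open>v\<close> is exact and contributes curvature
  \<open>1 / \<gamma>\<close>, of which weak convexity takes away at most \<open>c\<close>.\<close>

lemma prox_objective_strongly_convex:
  "prox_objective \<gamma> F x v + (F' v + (1 / \<gamma>) *\<^sub>R (v - x)) \<bullet> (w - v)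
     + (1 / \<gamma> - c) / 2 * (norm (w - v))\<^sup>2 \<le> prox_objective \<gamma> F x w"
proof -
  have "F v + F' v \<bullet> (w - v) - c / 2 * (norm (w - v))\<^sup>2 \<le> F w"
    using weakly_convex unfolding weak_convex_def by blast
  moreover have "(1 / \<gamma> - c) / 2 * (norm (w - v))\<^sup>2
      = 1 / (2 * \<gamma>) * (norm (w - v))\<^sup>2 - c / 2 * (norm (w - v))\<^sup>2"
    by (simp add: field_simps)
  moreover have "1 / (2 * \<gamma>) * (2 * ((v - x) \<bullet> (w - v))) = ((1 / \<gamma>) *\<^sub>R (v - x)) \<bullet> (w - v)"
    by simp
  ultimately show ?thesis
    unfolding prox_objective_def norm_diff_sq_expand[of x w v] inner_add_left distrib_left
    by linarith
qed

lemma prox_exists: "\<exists>y. \<forall>z. prox_objective \<gamma> F x y \<le> prox_objective \<gamma> F x z"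
proof -
  \<comment> \<open>The radius beyond which the quadratic term alone exceeds \<open>F x - L\<close>,
    so that outside the ball the objective is at least its value \<open>F x\<close> at the centre.
    The minimum over the compact ball is therefore global.\<close>
  define r where "r = sqrt (2 * \<gamma> * (F x - L))"
  have r: "0 \<le> r" "r\<^sup>2 = 2 * \<gamma> * (F x - L)"
    using gamma_pos bounded_below[of x] by (auto simp: r_def)
  have "continuous_on (cball x r) (prox_objective \<gamma> F x)"
    unfolding prox_objective_def[abs_def]
    by (intro continuous_intros continuous_on_subset[OF continuous]) auto
  then obtain y where y: "\<forall>z\<in>cball x r. prox_objective \<gamma> F x y \<le> prox_objective \<gamma> F x z"
    using continuous_attains_inf[of "cball x r" "prox_objective \<gamma> F x"] r by auto
  have "prox_objective \<gamma> F x y \<le> prox_objective \<gamma> F x z" if "z \<notin> cball x r" for z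
  proof -
    have "r\<^sup>2 \<le> (norm (x - z))\<^sup>2"
      using that r(1) by (intro power_mono) (auto simp: dist_norm)
    then have "F x - L \<le> 1 / (2 * \<gamma>) * (norm (x - z))\<^sup>2"
      using r(2) gamma_pos by (simp add: field_simps)
    then have "F x \<le> prox_objective \<gamma> F x z"
      using bounded_below[of z] by (simp add: prox_objective_def)
    moreover have "prox_objective \<gamma> F x y \<le> F x"
      using y r(1) by (auto simp: prox_objective_def dest: bspec[where x = x])
    ultimately show ?thesis by simp
  qed
  with y show ?thesis by blast
qed

lemma prox_minimal: "prox_objective \<gamma> F x (prox \<gamma> F x) \<le> prox_objective \<gamma> F x z"
  unfolding prox_def by (rule someI2_ex[OF prox_exists]) blast

text \<open>
  The vector \<open>F' y + (y - x) / \<gamma>\<close> at the proximal point \<open>y\<close> is some subgradient and may be nonzero, so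
  quadratic growth is obtained from a subgradient at an intermediate point instead.
\<close>

lemma prox_quadratic_growth:
  "prox_objective \<gamma> F x (prox \<gamma> F x) + (1 / \<gamma> - c) / 2 * (norm (z - prox \<gamma> F x))\<^sup>2
    \<le> prox_objective \<gamma> F x z"
proof -
  define y where "y = prox \<gamma> F x"
  define d where "d = (1 / \<gamma> - c) / 2 * (norm (z - y))\<^sup>2"
  have "t * d \<le> prox_objective \<gamma> F x z - prox_objective \<gamma> F x y" if t: "0 < t" "t < 1" for t
  proof -
    define v where "v = y + (1 - t) *\<^sub>R (z - y)"
    define q where "q = (F' v + (1 / \<gamma>) *\<^sub>R (v - x)) \<bullet> (z - y)"
    have zv: "z - v = t *\<^sub>R (z - y)" and yv: "y - v = (- (1 - t)) *\<^sub>R (z - y)"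
      by (simp_all add: v_def algebra_simps)
    have z: "prox_objective \<gamma> F x v + t * q + t\<^sup>2 * d \<le> prox_objective \<gamma> F x z"
      using prox_objective_strongly_convex[of x v z] t unfolding zv d_def
      unfolding inner_scaleR_right norm_scaleR power_mult_distrib q_def[symmetric]
      by (simp add: mult.left_commute)
    have y: "prox_objective \<gamma> F x v - (1 - t) * q + (1 - t)\<^sup>2 * d \<le> prox_objective \<gamma> F x y"
      using prox_objective_strongly_convex[of x v y] t unfolding yv d_def
      unfolding inner_scaleR_right norm_scaleR power_mult_distrib q_def[symmetric]
      by (simp add: mult.left_commute left_diff_distrib)
    \<comment> \<open>The weights \<open>1 - t\<close> and \<open>t\<close> cancel the term
      \<open>q\<close>, about which nothing is known. The curvature terms combine to
      \<open>(1 - t) * (t * d)\<close>, and the spare factor \<open>1 - t\<close> is divided out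
      below.\<close>
    have "(1 - t) * (prox_objective \<gamma> F x v + t * q + t\<^sup>2 * d)
        + t * (prox_objective \<gamma> F x v - (1 - t) * q + (1 - t)\<^sup>2 * d)
        \<le> (1 - t) * prox_objective \<gamma> F x z + t * prox_objective \<gamma> F x y"
      using t by (intro add_mono mult_left_mono z y) auto
    moreover have "(1 - t) * (prox_objective \<gamma> F x v + t * q + t\<^sup>2 * d)
        + t * (prox_objective \<gamma> F x v - (1 - t) * q + (1 - t)\<^sup>2 * d)
        = prox_objective \<gamma> F x v + (1 - t) * (t * d)"
      by (simp add: algebra_simps power2_eq_square)
    moreover have "prox_objective \<gamma> F x y \<le> prox_objective \<gamma> F x v"
      unfolding y_def by (rule prox_minimal)
    ultimately have "(1 - t) * (t * d)
        \<le> (1 - t) * (prox_objective \<gamma> F x z - prox_objective \<gamma> F x y)"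
      by (simp add: algebra_simps)
    then show ?thesis using t by simp
  qed
  \<comment> \<open>This is the limit \<open>t\<close> to 1, in which the intermediate point
    \<open>v\<close> approaches \<open>y\<close> without a subgradient at \<open>y\<close> being
    used.\<close>
  from field_le_mult_one_interval[OF this] show ?thesis
    unfolding d_def y_def by linarith
qed

text \<open>Adding the quadratic growth at each proximal point, tested at the other one, cancels all
  values of \<open>F\<close> and leaves an inner product of the two differences. The bound gives
  measurability and moments of proximal points as well as differentiability of the envelope.\<close>

lemma prox_lipschitz:
  "norm (prox \<gamma> F x - prox \<gamma> F x') \<le> 1 / (1 - c * \<gamma>) * norm (x - x')"
proof -
  define y y' where "y = prox \<gamma> F x" and "y' = prox \<gamma> F x'"
  have "(1 / \<gamma> - c) * (norm (y - y'))\<^sup>2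
      \<le> 1 / (2 * \<gamma>) * ((norm (x - y'))\<^sup>2 - (norm (x - y))\<^sup>2 + (norm (x' - y))\<^sup>2 - (norm (x' - y'))\<^sup>2)"
    using prox_quadratic_growth[of x y'] prox_quadratic_growth[of x' y]
    unfolding y_def[symmetric] y'_def[symmetric] prox_objective_def norm_minus_commute[of y' y]
    by (simp add: algebra_simps add_divide_distrib diff_divide_distrib)
  also have "\<dots> = (1 / \<gamma>) * ((x - x') \<bullet> (y - y'))"
    by (simp add: power2_norm_eq_inner inner_diff_left inner_diff_right inner_commute algebra_simps)
  also have "\<dots> \<le> (1 / \<gamma>) * (norm (x - x') * norm (y - y'))"
    using gamma_pos by (intro mult_left_mono norm_cauchy_schwarz) auto
  finally have "\<gamma> * ((1 / \<gamma> - c) * (norm (y - y'))\<^sup>2)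
      \<le> \<gamma> * ((1 / \<gamma>) * (norm (x - x') * norm (y - y')))"
    using gamma_pos by (intro mult_left_mono) auto
  then have "(1 - c * \<gamma>) * (norm (y - y'))\<^sup>2 \<le> norm (x - x') * norm (y - y')"
    using gamma_pos by (simp add: left_diff_distrib right_diff_distrib mult.commute mult.left_commute)
  then have "(1 - c * \<gamma>) * norm (y - y') \<le> norm (x - x')"
    by (cases "norm (y - y') = 0") (auto simp: power2_eq_square mult.assoc[symmetric])
  then show ?thesis
    using gamma_less by (simp add: field_simps y_def y'_def)
qed

lemma continuous_prox: "continuous_on UNIV (prox \<gamma> F)"
proof (rule lipschitz_on_continuous_on)
  show "(1 / (1 - c * \<gamma>))-lipschitz_on UNIV (prox \<gamma> F)"
    using prox_lipschitz gamma_less by (intro lipschitz_onI) (auto simp: dist_norm)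
qed

text \<open>Applied to \<open>wstar\<close>, this fixed point combines with the Lipschitz bound to
  control the distance of a proximal point from \<open>wstar\<close> by the distance of its
  centre.\<close>

lemma prox_minimizer: "prox \<gamma> F v = v" if "\<And>x. F v \<le> F x"
proof -
  have "prox_objective \<gamma> F v v \<le> prox_objective \<gamma> F v (prox \<gamma> F v)"
    using that[of "prox \<gamma> F v"] gamma_pos by (simp add: prox_objective_def add_increasing2)
  then have "(1 / \<gamma> - c) / 2 * (norm (v - prox \<gamma> F v))\<^sup>2 \<le> 0"
    using prox_quadratic_growth[of v v] by linarith
  then show ?thesis
    using modulus_pos by (auto simp: mult_le_0_iff)
qed

section \<open>The gradient of the Moreau envelope\<close>

lemma moreau_envelope_eq: "moreau_envelope \<gamma> F x = prox_objective \<gamma> F x (prox \<gamma> F x)"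
  unfolding moreau_envelope_def prox_objective_def[symmetric]
  by (intro cInf_eq_minimum) (auto intro: prox_minimal)

text \<open>The proximal point of \<open>x\<close> is merely a competitor in the minimisation at
  \<open>x'\<close>; expanding its quadratic about \<open>x\<close> gives the upper half of a Taylor
  estimate.\<close>

lemma moreau_envelope_le:
  "moreau_envelope \<gamma> F x' \<le> moreau_envelope \<gamma> F x
     + (x' - x) \<bullet> ((1 / \<gamma>) *\<^sub>R (x - prox \<gamma> F x)) + 1 / (2 * \<gamma>) * (norm (x' - x))\<^sup>2"
proof -
  have "moreau_envelope \<gamma> F x' \<le> prox_objective \<gamma> F x' (prox \<gamma> F x)"
    unfolding moreau_envelope_eq by (rule prox_minimal)
  also have "\<dots> = moreau_envelope \<gamma> F x
     + (x' - x) \<bullet> ((1 / \<gamma>) *\<^sub>R (x - prox \<gamma> F x)) + 1 / (2 * \<gamma>) * (norm (x' - x))\<^sup>2"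
    unfolding moreau_envelope_eq prox_objective_def using gamma_pos
    by (simp add: power2_norm_eq_inner inner_diff_left inner_diff_right inner_commute field_simps)
  finally show ?thesis .
qed

text \<open>The upper half of a quadratic Taylor bound is already known. The lower half is the same
  inequality with \<open>x\<close> and \<open>x'\<close> exchanged; it involves the candidate
  gradient at \<open>x'\<close>, which is moved back to \<open>x\<close> by Lipschitz continuity of
  the prox map. The two terms of \<open>K\<close> are the costs of these two operations.\<close>

lemma GDERIV_moreau_envelope:
  "GDERIV (moreau_envelope \<gamma> F) x :> (1 / \<gamma>) *\<^sub>R (x - prox \<gamma> F x)"
proof -
  define K where "K = 1 / (2 * \<gamma>) + (1 / \<gamma>) * (1 + 1 / (1 - c * \<gamma>))"
  define v where "v = (1 / \<gamma>) *\<^sub>R (x - prox \<gamma> F x)"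
  have K: "0 \<le> K"
    using gamma_pos gamma_less by (simp add: K_def)
  have taylor: "\<bar>moreau_envelope \<gamma> F x' - moreau_envelope \<gamma> F x - (x' - x) \<bullet> v\<bar>
      \<le> K * (norm (x' - x))\<^sup>2" for x'
  proof (rule abs_leI)
    have "0 \<le> (1 / \<gamma>) * (1 + 1 / (1 - c * \<gamma>)) * (norm (x' - x))\<^sup>2"
      using gamma_pos gamma_less by simp
    then show "moreau_envelope \<gamma> F x' - moreau_envelope \<gamma> F x - (x' - x) \<bullet> v \<le> K * (norm (x' - x))\<^sup>2"
      using moreau_envelope_le[of x' x] by (simp add: K_def v_def algebra_simps)
    \<comment> \<open>The change of the residual \<open>x - prox \<gamma> F x\<close> between the
      two points, that is, \<gamma> times the change of the candidate gradient.\<close>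
    define e where "e = (x' - x) - (prox \<gamma> F x' - prox \<gamma> F x)"
    have "norm e \<le> norm (x' - x) + 1 / (1 - c * \<gamma>) * norm (x' - x)"
      unfolding e_def using norm_triangle_ineq4 prox_lipschitz by (rule order_trans[OF _ add_left_mono])
    then have e: "norm e \<le> (1 + 1 / (1 - c * \<gamma>)) * norm (x' - x)"
      by (simp add: algebra_simps)
    have "- ((x' - x) \<bullet> e) \<le> norm (x' - x) * norm e"
      using norm_cauchy_schwarz[of "x - x'" e] by (simp add: norm_minus_commute inner_diff_left)
    also have "\<dots> \<le> norm (x' - x) * ((1 + 1 / (1 - c * \<gamma>)) * norm (x' - x))"
      using e by (intro mult_left_mono) auto
    finally have e': "- ((x' - x) \<bullet> e) \<le> (1 + 1 / (1 - c * \<gamma>)) * (norm (x' - x))\<^sup>2"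
      by (simp add: power2_eq_square ac_simps)
    have "moreau_envelope \<gamma> F x - moreau_envelope \<gamma> F x'
        \<le> (x - x') \<bullet> ((1 / \<gamma>) *\<^sub>R (x' - prox \<gamma> F x')) + 1 / (2 * \<gamma>) * (norm (x' - x))\<^sup>2"
      using moreau_envelope_le[of x x'] by (simp add: norm_minus_commute)
    also have "(1 / \<gamma>) *\<^sub>R (x' - prox \<gamma> F x') = v + (1 / \<gamma>) *\<^sub>R e"
      by (simp add: v_def e_def algebra_simps)
    also have "(x - x') \<bullet> (v + (1 / \<gamma>) *\<^sub>R e) = - ((x' - x) \<bullet> v) + (1 / \<gamma>) * (- ((x' - x) \<bullet> e))"
      by (simp add: inner_add_right inner_diff_left algebra_simps)
    also have "\<dots> \<le> - ((x' - x) \<bullet> v) + (1 / \<gamma>) * ((1 + 1 / (1 - c * \<gamma>)) * (norm (x' - x))\<^sup>2)"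
      using e' gamma_pos by (intro add_left_mono mult_left_mono) auto
    finally show "- (moreau_envelope \<gamma> F x' - moreau_envelope \<gamma> F x - (x' - x) \<bullet> v)
        \<le> K * (norm (x' - x))\<^sup>2"
      by (simp add: K_def distrib_right distrib_left add_divide_distrib)
  qed
  have "((\<lambda>x'. K * norm (x' - x)) \<longlongrightarrow> K * norm (x - x)) (at x)"
    by (intro tendsto_intros)
  then have lim: "((\<lambda>x'. K * norm (x' - x)) \<longlongrightarrow> 0) (at x)" by simp
  have "((\<lambda>x'. (moreau_envelope \<gamma> F x' - moreau_envelope \<gamma> F x - (x' - x) \<bullet> v) /\<^sub>R norm (x' - x))
      \<longlongrightarrow> 0) (at x)"
  proof (rule Lim_null_comparison[OF _ lim], rule always_eventually, rule allI)
    fix x'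
    show "norm ((moreau_envelope \<gamma> F x' - moreau_envelope \<gamma> F x - (x' - x) \<bullet> v) /\<^sub>R norm (x' - x))
        \<le> K * norm (x' - x)"
      using taylor[of x'] K
      by (cases "x' = x") (auto simp: field_simps power2_eq_square)
  qed
  then show ?thesis
    unfolding gderiv_def v_def[symmetric] has_derivative_within[of _ _ _ UNIV]
    by (simp add: bounded_linear_inner_left diff_diff_eq divide_inverse mult.commute)
qed

lemma grad_moreau_envelope: "grad (moreau_envelope \<gamma> F) x = (1 / \<gamma>) *\<^sub>R (x - prox \<gamma> F x)"
  using GDERIV_moreau_envelope by (rule grad_eq)

end

section \<open>Deterministic descent for an average of iterates\<close>

lemma (in weakly_convex) average_descent:
  fixes z :: "nat \<Rightarrow> real^'d" and x :: "real^'d"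
  defines "y \<equiv> prox \<gamma> F x"
  assumes gamma: "\<gamma> = 1 / (2 * c)" and T: "T > 0"
  shows "F ((1 / real T) *\<^sub>R (\<Sum>t<T. z t)) + c * (norm (x - y))\<^sup>2
    \<le> F x + 3 / 2 * ((1 / real T) * (\<Sum>t<T. (F' (z t) + (1 / \<gamma>) *\<^sub>R (z t - x)) \<bullet> (z t - y)))"
proof -
  define h where "h = (\<lambda>t. (F' (z t) + (1 / \<gamma>) *\<^sub>R (z t - x)) \<bullet> (z t - y))"
  define a where "a = (1 / real T) *\<^sub>R (\<Sum>t<T. z t)"
  define g where "g = F' a + (1 / \<gamma>) *\<^sub>R (a - x)"
  define \<phi> where "\<phi> = prox_objective \<gamma> F x"
  have c: "0 < c" "1 / \<gamma> - c = c"
    using gamma gamma_pos by (auto simp: zero_less_divide_iff)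
  have sum_dev: "(\<Sum>t<T. z t - a) = 0"
    using T by (simp add: a_def sum_subtractf sum_constant_scaleR del: sum_constant)
  \<comment> \<open>Strong convexity is used twice, based at \<open>z t\<close> and tested at
    \<open>y\<close>, then based at \<open>a\<close> and tested at \<open>z t\<close>. Expanding the
    square about \<open>a\<close> leaves only terms linear in \<open>z t - a\<close>, which vanish
    on summation because \<open>a\<close> is the mean.\<close>
  have step: "\<phi> a - \<phi> y + c / 2 * (norm (a - y))\<^sup>2 + (g + c *\<^sub>R (a - y)) \<bullet> (z t - a) \<le> h t" for t
  proof -
    have "\<phi> (z t) - h t + c / 2 * (norm (y - z t))\<^sup>2 \<le> \<phi> y"
      using prox_objective_strongly_convex[of x "z t" y]
      unfolding c(2) \<phi>_def[symmetric] h_def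
      by (simp add: inner_diff_right)
    moreover have "\<phi> a + g \<bullet> (z t - a) + c / 2 * (norm (z t - a))\<^sup>2 \<le> \<phi> (z t)"
      using prox_objective_strongly_convex[of x a "z t"]
      unfolding c(2) \<phi>_def[symmetric] g_def .
    moreover have "c / 2 * (norm (y - z t))\<^sup>2 =
        c / 2 * (norm (a - y))\<^sup>2 + (c *\<^sub>R (a - y)) \<bullet> (z t - a) + c / 2 * (norm (z t - a))\<^sup>2"
      unfolding norm_diff_sq_expand[of y "z t" a]
      by (simp add: norm_minus_commute distrib_left)
    moreover have "0 \<le> c / 2 * (norm (z t - a))\<^sup>2" using c by simp
    ultimately show ?thesis unfolding inner_add_left by linarith
  qed
  have "(\<Sum>t<T. \<phi> a - \<phi> y + c / 2 * (norm (a - y))\<^sup>2 + (g + c *\<^sub>R (a - y)) \<bullet> (z t - a))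
      \<le> (\<Sum>t<T. h t)"
    by (rule sum_mono) (rule step)
  then have "real T * (\<phi> a - \<phi> y + c / 2 * (norm (a - y))\<^sup>2) \<le> (\<Sum>t<T. h t)"
    by (simp only: sum.distrib inner_sum_right[symmetric] sum_dev sum_constant) (simp add: distrib_left)
  then have gap: "\<phi> a - \<phi> y + c / 2 * (norm (a - y))\<^sup>2 \<le> (1 / real T) * (\<Sum>t<T. h t)"
    using T by (simp add: field_simps)
  \<comment> \<open>Growth at \<open>a\<close> turns the gap bound into a bound on the distance from
    \<open>a\<close> to \<open>y\<close>. Growth at \<open>x\<close> yields one half of the wanted
    multiple of \<open>(norm (x - y))\<^sup>2\<close>; the parallelogram bound below yields the
    other half.\<close>
  have "\<phi> y + c / 2 * (norm (a - y))\<^sup>2 \<le> \<phi> a" "\<phi> y + c / 2 * (norm (x - y))\<^sup>2 \<le> \<phi> x"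
    using prox_quadratic_growth[of x a] prox_quadratic_growth[of x x]
    unfolding c(2) \<phi>_def[symmetric] y_def[symmetric] by auto
  moreover have "\<phi> x = F x" "\<phi> a = F a + c * (norm (x - a))\<^sup>2"
    using gamma c(1) by (auto simp: \<phi>_def prox_objective_def)
  moreover have "c / 2 * (norm (x - y))\<^sup>2 \<le> c * (norm (x - a))\<^sup>2 + c * (norm (a - y))\<^sup>2"
  proof -
    have "(norm (x - y))\<^sup>2 \<le> 2 * (norm (x - a))\<^sup>2 + 2 * (norm (a - y))\<^sup>2"
      using norm_add_sq_le[of "x - a" "a - y"] by simp
    from mult_left_mono[OF this, of "c / 2"] c(1) show ?thesis
      by (simp add: distrib_left)
  qed
  ultimately show ?thesis
    using gap unfolding h_def[symmetric] a_def[symmetric] by linarith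
qed

section \<open>The virtual iterates of M-DSGD\<close>

text \<open>Each of the \<open>p * b\<close> samples contributes the same regularising vector, so
  the normalisation leaves exactly one copy. Only the loss part of the aggregate is random given the
  two points.\<close>

lemma aggregated_grad_regularised:
  assumes "p \<ge> 1" "b \<ge> 1" and "\<And>k. k \<in> {1..p} \<Longrightarrow> size (I k) = b"
  shows "aggregated_grad p b (regularised_grad \<gamma> df x) I w
    = aggregated_grad p b df I w + (1 / \<gamma>) *\<^sub>R (w - x)"
proof -
  have const: "(\<Sum>i\<in>#A. a) = real (size A) *\<^sub>R a" for A :: "nat multiset" and a :: "real^'d"
    by (induction A) (simp_all add: algebra_simps)
  have "worker_grad p b (regularised_grad \<gamma> df x) (I k) w
      = worker_grad p b df (I k) w + (1 / real p) *\<^sub>R ((1 / \<gamma>) *\<^sub>R (w - x))" if "k \<in> {1..p}" for k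
    using assms(2) assms(3)[OF that] unfolding worker_grad_def regularised_grad_def sum_mset.distrib const
    by (simp add: scaleR_right_distrib)
  then have "aggregated_grad p b (regularised_grad \<gamma> df x) I w
      = (\<Sum>k=1..p. worker_grad p b df (I k) w + (1 / real p) *\<^sub>R ((1 / \<gamma>) *\<^sub>R (w - x)))"
    unfolding aggregated_grad_def by (intro sum.cong) auto
  then show ?thesis
    using assms(1) by (simp add: sum.distrib aggregated_grad_def sum_constant_scaleR del: sum_constant)
qed

locale mdsgd =
  fixes p b :: nat and dphi :: "nat \<Rightarrow> real^'d \<Rightarrow> real^'d" and v :: "real^'d" and \<eta> \<beta> :: real
    and I :: "nat \<Rightarrow> nat \<Rightarrow> nat multiset" and m :: "nat \<Rightarrow> nat \<Rightarrow> real^'d"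
  assumes beta: "0 \<le> \<beta>" "\<beta> < 1"
begin

definition iterate :: "nat \<Rightarrow> real^'d"
  where "iterate t = fst (mdsgd_state p b dphi v \<eta> \<beta> I m t)"

definition momentum :: "nat \<Rightarrow> real^'d"
  where "momentum t = (\<Sum>k=1..p. fst (snd (mdsgd_state p b dphi v \<eta> \<beta> I m t)) k)"

definition memory :: "nat \<Rightarrow> real^'d"
  where "memory t = (\<Sum>k=1..p. snd (snd (mdsgd_state p b dphi v \<eta> \<beta> I m t)) k)"

definition batch_grad :: "nat \<Rightarrow> real^'d"
  where "batch_grad t = aggregated_grad p b dphi (I t) (iterate t)"

text \<open>Up to the factor \<eta>, this is the motion still pending at time \<open>t\<close>: the
  unsent memory, and the geometric series \<beta> + \<beta>^2 + ... with which the current momentum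
  would keep acting if no further gradients arrived. Here \<open>momentum t\<close> is the aggregate
  momentum of time \<open>t - 1\<close>.\<close>

definition drift :: "nat \<Rightarrow> real^'d"
  where "drift t = memory t + (\<beta> / (1 - \<beta>)) *\<^sub>R momentum t"

lemma initial [simp]: "iterate 0 = v" "momentum 0 = 0" "memory 0 = 0"
  by (simp_all add: iterate_def momentum_def memory_def)

lemma momentum_Suc: "momentum (Suc t) = \<beta> *\<^sub>R momentum t + batch_grad t"
  by (simp add: momentum_def batch_grad_def iterate_def aggregated_grad_def split_beta Let_def
      sum.distrib scaleR_sum_right)

text \<open>For each worker the part sent and the part kept add up to the whole vector, so the masks
  cancel from the iterate minus \<eta> times the memory.\<close>

lemma iterate_memory_Suc:
  "iterate (Suc t) - \<eta> *\<^sub>R memory (Suc t) = iterate t - \<eta> *\<^sub>R (momentum (Suc t) + memory t)"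
proof -
  obtain w g u where st: "mdsgd_state p b dphi v \<eta> \<beta> I m t = (w, g, u)"
    by (metis prod_cases3)
  define g' where "g' = (\<lambda>k. \<beta> *\<^sub>R g k + worker_grad p b dphi (I t k) w)"
  define r where "r = (\<Sum>k=1..p. m t k * (g' k + u k))"
  have "memory (Suc t) + r = (\<Sum>k=1..p. g' k + u k)"
    unfolding memory_def r_def by (simp add: st Let_def g'_def sum.distrib[symmetric] algebra_simps)
  moreover have "iterate (Suc t) = iterate t - \<eta> *\<^sub>R r"
    unfolding iterate_def r_def by (simp add: st Let_def g'_def)
  moreover have "momentum (Suc t) + memory t = (\<Sum>k=1..p. g' k + u k)"
    unfolding momentum_def memory_def by (simp add: st Let_def g'_def sum.distrib)
  ultimately have "momentum (Suc t) + memory t = memory (Suc t) + r"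
    "iterate (Suc t) = iterate t - \<eta> *\<^sub>R r"
    by simp_all
  then show ?thesis
    by (simp add: scaleR_right_distrib)
qed

lemma virtual_Suc:
  "iterate (Suc t) - \<eta> *\<^sub>R drift (Suc t)
    = (iterate t - \<eta> *\<^sub>R drift t) - (\<eta> / (1 - \<beta>)) *\<^sub>R batch_grad t"
proof -
  define r where "r = \<beta> / (1 - \<beta>)"
  \<comment> \<open>The second identity says that the coefficient of the old momentum reproduces
    itself, which determines the factor \<beta>/(1-\<beta>) in \<open>drift\<close>.\<close>
  have r: "1 / (1 - \<beta>) = 1 + r" "(1 + r) * \<beta> = r"
    using beta by (simp_all add: r_def field_simps)
  have "iterate (Suc t) - \<eta> *\<^sub>R drift (Suc t)
      = iterate t - \<eta> *\<^sub>R (momentum (Suc t) + memory t) - (\<eta> * r) *\<^sub>R momentum (Suc t)"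
    unfolding drift_def r_def[symmetric] iterate_memory_Suc[symmetric]
    by (simp add: algebra_simps)
  also have "\<dots> = iterate t - \<eta> *\<^sub>R memory t - (\<eta> * (1 + r)) *\<^sub>R momentum (Suc t)"
    by (simp add: algebra_simps)
  also have "(\<eta> * (1 + r)) *\<^sub>R momentum (Suc t)
      = (\<eta> * ((1 + r) * \<beta>)) *\<^sub>R momentum t + (\<eta> * (1 + r)) *\<^sub>R batch_grad t"
    unfolding momentum_Suc by (simp add: scaleR_right_distrib mult.assoc)
  also have "\<eta> * (1 + r) = \<eta> / (1 - \<beta>)"
    using r(1) by (metis times_divide_eq_right mult.right_neutral)
  finally show ?thesis
    unfolding r(2) drift_def r_def[symmetric] by (simp add: algebra_simps)
qed

text \<open>The squared distance of the virtual point to \<open>y\<close> telescopes. Gradients are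
  evaluated at the iterate and not at the virtual point, which costs the inner product with
  \<open>drift\<close>; the virtual sequence starts at \<open>v\<close> because nothing is pending
  at time 0.\<close>

lemma regret:
  fixes y :: "real^'d" and T :: nat
  defines "\<kappa> \<equiv> \<eta> / (1 - \<beta>)"
  shows "2 * \<kappa> * (\<Sum>t<T. batch_grad t \<bullet> (iterate t - y))
    \<le> (norm (v - y))\<^sup>2
      + (\<Sum>t<T. 2 * \<kappa> * \<eta> * (batch_grad t \<bullet> drift t) + \<kappa>\<^sup>2 * (norm (batch_grad t))\<^sup>2)"
proof -
  define z where "z = (\<lambda>t. iterate t - \<eta> *\<^sub>R drift t)"
  have step: "(norm (z (Suc t) - y))\<^sup>2 = (norm (z t - y))\<^sup>2
      - 2 * \<kappa> * (batch_grad t \<bullet> (iterate t - y))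
      + (2 * \<kappa> * \<eta> * (batch_grad t \<bullet> drift t) + \<kappa>\<^sup>2 * (norm (batch_grad t))\<^sup>2)" for t
  proof -
    have *: "iterate t - y = (z t - y) + \<eta> *\<^sub>R drift t" "z (Suc t) - y = (z t - y) - \<kappa> *\<^sub>R batch_grad t"
      using virtual_Suc[of t] by (simp_all add: z_def \<kappa>_def)
    show ?thesis
      unfolding *
      by (simp add: power2_norm_eq_inner inner_diff_left inner_diff_right inner_add_right
          inner_commute algebra_simps power2_eq_square[of \<kappa>])
  qed
  have "2 * \<kappa> * (\<Sum>t<T. batch_grad t \<bullet> (iterate t - y)) + (norm (z T - y))\<^sup>2 = (norm (v - y))\<^sup>2
      + (\<Sum>t<T. 2 * \<kappa> * \<eta> * (batch_grad t \<bullet> drift t) + \<kappa>\<^sup>2 * (norm (batch_grad t))\<^sup>2)"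
  proof (induction T)
    case 0
    show ?case by (simp add: z_def drift_def)
  next
    case (Suc T)
    then show ?case using step[of T] by (simp add: distrib_left)
  qed
  then show ?thesis by (smt (verit) zero_le_power2)
qed

text \<open>Convexity of the squared norm with weights \<beta> and 1-\<beta>, the gradient being
  written as \<open>1 - \<beta>\<close> times a rescaled vector. The resulting recursion reproduces
  a bound of the form A/(1-\<beta>)^2.\<close>

lemma norm_momentum_Suc:
  "(norm (momentum (Suc t)))\<^sup>2 \<le> \<beta> * (norm (momentum t))\<^sup>2 + (norm (batch_grad t))\<^sup>2 / (1 - \<beta>)"
proof -
  define a where "a = (1 / (1 - \<beta>)) *\<^sub>R batch_grad t"
  have bg: "batch_grad t = (1 - \<beta>) *\<^sub>R a" using beta by (simp add: a_def)
  have "(norm (\<beta> *\<^sub>R momentum t + (1 - \<beta>) *\<^sub>R a))\<^sup>2 + \<beta> * (1 - \<beta>) * (norm (momentum t - a))\<^sup>2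
      = \<beta> * (norm (momentum t))\<^sup>2 + (1 - \<beta>) * (norm a)\<^sup>2"
    by (simp add: power2_norm_eq_inner inner_diff_left inner_diff_right inner_add_right
          inner_add_left inner_commute algebra_simps)
  moreover have "0 \<le> \<beta> * (1 - \<beta>) * (norm (momentum t - a))\<^sup>2" using beta by simp
  moreover have "(1 - \<beta>) * (norm a)\<^sup>2 = (norm (batch_grad t))\<^sup>2 / (1 - \<beta>)"
    using beta unfolding bg by (simp add: power_mult_distrib power2_eq_square)
  ultimately show ?thesis unfolding momentum_Suc bg by linarith
qed

end

section \<open>Square-integrable random vectors\<close>

definition square_integrable :: "'s measure \<Rightarrow> ('s \<Rightarrow> 'a::euclidean_space) \<Rightarrow> bool"
  where "square_integrable M X \<longleftrightarrow>
    X \<in> borel_measurable M \<and> integrable M (\<lambda>\<omega>. (norm (X \<omega>))\<^sup>2)"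

lemma square_integrable_measurable: "square_integrable M X \<Longrightarrow> X \<in> borel_measurable M"
  and square_integrable_integrable: "square_integrable M X \<Longrightarrow> integrable M (\<lambda>\<omega>. (norm (X \<omega>))\<^sup>2)"
  by (simp_all add: square_integrable_def)

lemma square_integrable_dominated:
  assumes [measurable]: "X \<in> borel_measurable M"
    and "integrable M b" "\<And>\<omega>. \<omega> \<in> space M \<Longrightarrow> (norm (X \<omega>))\<^sup>2 \<le> b \<omega>"
  shows "square_integrable M X"
  unfolding square_integrable_def
proof
  show "integrable M (\<lambda>\<omega>. (norm (X \<omega>))\<^sup>2)"
  proof (rule Bochner_Integration.integrable_bound[OF assms(2)])
    show "AE \<omega> in M. norm ((norm (X \<omega>))\<^sup>2) \<le> norm (b \<omega>)"
      using assms(3) by (intro AE_I2) force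
  qed measurable
qed (rule assms(1))

lemma square_integrable_add:
  assumes "square_integrable M X" "square_integrable M Y"
  shows "square_integrable M (\<lambda>\<omega>. X \<omega> + Y \<omega>)"
    and "(\<integral>\<omega>. (norm (X \<omega> + Y \<omega>))\<^sup>2 \<partial>M)
      \<le> 2 * (\<integral>\<omega>. (norm (X \<omega>))\<^sup>2 \<partial>M) + 2 * (\<integral>\<omega>. (norm (Y \<omega>))\<^sup>2 \<partial>M)"
proof -
  note [simp] = square_integrable_integrable[OF assms(1)] square_integrable_integrable[OF assms(2)]
  note [measurable] = square_integrable_measurable[OF assms(1)] square_integrable_measurable[OF assms(2)]
  show *: "square_integrable M (\<lambda>\<omega>. X \<omega> + Y \<omega>)"
    by (rule square_integrable_dominated[where b = "\<lambda>\<omega>. 2 * (norm (X \<omega>))\<^sup>2 + 2 * (norm (Y \<omega>))\<^sup>2"])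
      (auto intro: norm_add_sq_le)
  have "(\<integral>\<omega>. (norm (X \<omega> + Y \<omega>))\<^sup>2 \<partial>M) \<le> (\<integral>\<omega>. 2 * (norm (X \<omega>))\<^sup>2 + 2 * (norm (Y \<omega>))\<^sup>2 \<partial>M)"
    by (intro integral_mono square_integrable_integrable[OF *] norm_add_sq_le) simp
  then show "(\<integral>\<omega>. (norm (X \<omega> + Y \<omega>))\<^sup>2 \<partial>M)
      \<le> 2 * (\<integral>\<omega>. (norm (X \<omega>))\<^sup>2 \<partial>M) + 2 * (\<integral>\<omega>. (norm (Y \<omega>))\<^sup>2 \<partial>M)"
    by simp
qed

lemma square_integrable_scaleR:
  assumes "square_integrable M X"
  shows "square_integrable M (\<lambda>\<omega>. r *\<^sub>R X \<omega>)"
    and "(\<integral>\<omega>. (norm (r *\<^sub>R X \<omega>))\<^sup>2 \<partial>M) = r\<^sup>2 * (\<integral>\<omega>. (norm (X \<omega>))\<^sup>2 \<partial>M)"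
  using assms by (auto simp: square_integrable_def power_mult_distrib)

lemma square_integrable_minus_commute:
  "square_integrable M (\<lambda>\<omega>. X \<omega> - Y \<omega>) \<Longrightarrow> square_integrable M (\<lambda>\<omega>. Y \<omega> - X \<omega>)"
  using square_integrable_scaleR(1)[of M "\<lambda>\<omega>. X \<omega> - Y \<omega>" "- 1"] by simp

lemma square_integrable_inner:
  assumes "square_integrable M X" "square_integrable M Y"
  shows "integrable M (\<lambda>\<omega>. X \<omega> \<bullet> Y \<omega>)"
proof (rule Bochner_Integration.integrable_bound)
  note [measurable] = square_integrable_measurable[OF assms(1)] square_integrable_measurable[OF assms(2)]
  show "integrable M (\<lambda>\<omega>. (norm (X \<omega>))\<^sup>2 + (norm (Y \<omega>))\<^sup>2)"
    using assms by (auto simp: square_integrable_def)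
  show "(\<lambda>\<omega>. X \<omega> \<bullet> Y \<omega>) \<in> borel_measurable M" by measurable
  have "\<bar>X \<omega> \<bullet> Y \<omega>\<bar> \<le> (norm (X \<omega>))\<^sup>2 + (norm (Y \<omega>))\<^sup>2" for \<omega>
  proof -
    have "\<bar>X \<omega> \<bullet> Y \<omega>\<bar> \<le> norm (X \<omega>) * norm (Y \<omega>)" by (rule Cauchy_Schwarz_ineq2)
    moreover have "2 * (norm (X \<omega>) * norm (Y \<omega>)) \<le> (norm (X \<omega>))\<^sup>2 + (norm (Y \<omega>))\<^sup>2"
      using sum_squares_bound[of "norm (X \<omega>)" "norm (Y \<omega>)"] by (simp add: mult.assoc)
    moreover have "0 \<le> norm (X \<omega>) * norm (Y \<omega>)" by simp
    ultimately show ?thesis by linarith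
  qed
  then show "AE \<omega> in M. norm (X \<omega> \<bullet> Y \<omega>) \<le> norm ((norm (X \<omega>))\<^sup>2 + (norm (Y \<omega>))\<^sup>2)"
    by (intro AE_I2) (simp add: abs_of_nonneg)
qed

text \<open>Young's inequality with free scale factors is integrated and then used with factors
  \<open>b\<close> and \<open>a\<close>, after which \<open>a * b\<close> cancels. If one bound is
  0, the corresponding vector vanishes almost everywhere.\<close>

lemma square_integrable_Cauchy_Schwarz:
  assumes "square_integrable M X" "square_integrable M Y"
    and "(\<integral>\<omega>. (norm (X \<omega>))\<^sup>2 \<partial>M) \<le> a\<^sup>2" "(\<integral>\<omega>. (norm (Y \<omega>))\<^sup>2 \<partial>M) \<le> b\<^sup>2" "0 \<le> a" "0 \<le> b"
  shows "(\<integral>\<omega>. X \<omega> \<bullet> Y \<omega> \<partial>M) \<le> a * b"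
proof -
  note [simp] = square_integrable_integrable[OF assms(1)] square_integrable_integrable[OF assms(2)]
    square_integrable_inner[OF assms(1,2)]
  have young: "2 * r * s * (\<integral>\<omega>. X \<omega> \<bullet> Y \<omega> \<partial>M) \<le> r\<^sup>2 * a\<^sup>2 + s\<^sup>2 * b\<^sup>2" for r s :: real
  proof -
    have "2 * r * s * (X \<omega> \<bullet> Y \<omega>) \<le> r\<^sup>2 * (norm (X \<omega>))\<^sup>2 + s\<^sup>2 * (norm (Y \<omega>))\<^sup>2" for \<omega>
    proof -
      have "0 \<le> (norm (r *\<^sub>R X \<omega> - s *\<^sub>R Y \<omega>))\<^sup>2" by simp
      also have "\<dots> = r\<^sup>2 * (norm (X \<omega>))\<^sup>2 + s\<^sup>2 * (norm (Y \<omega>))\<^sup>2 - 2 * r * s * (X \<omega> \<bullet> Y \<omega>)"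
        unfolding power2_norm_eq_inner
        by (simp add: inner_diff_left inner_diff_right inner_commute power2_eq_square algebra_simps)
      finally show ?thesis by simp
    qed
    then have "(\<integral>\<omega>. 2 * r * s * (X \<omega> \<bullet> Y \<omega>) \<partial>M)
        \<le> (\<integral>\<omega>. r\<^sup>2 * (norm (X \<omega>))\<^sup>2 + s\<^sup>2 * (norm (Y \<omega>))\<^sup>2 \<partial>M)"
      by (intro integral_mono) auto
    also have "\<dots> = r\<^sup>2 * (\<integral>\<omega>. (norm (X \<omega>))\<^sup>2 \<partial>M) + s\<^sup>2 * (\<integral>\<omega>. (norm (Y \<omega>))\<^sup>2 \<partial>M)" by simp
    also have "\<dots> \<le> r\<^sup>2 * a\<^sup>2 + s\<^sup>2 * b\<^sup>2"
      using assms(3,4) by (intro add_mono mult_left_mono) auto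
    finally show ?thesis by simp
  qed
  show ?thesis
  proof (cases "a = 0 \<or> b = 0")
    case False
    then have ab: "0 < a" "0 < b" using assms(5,6) by auto
    have "2 * (a * b) * (\<integral>\<omega>. X \<omega> \<bullet> Y \<omega> \<partial>M) \<le> 2 * (a * b) * (a * b)"
      using young[of b a] by (simp add: power2_eq_square ac_simps)
    then show ?thesis using ab by simp
  next
    case True
    have zero: "(\<integral>\<omega>. (norm (Z \<omega>))\<^sup>2 \<partial>M) \<le> 0 \<Longrightarrow> square_integrable M Z \<Longrightarrow> AE \<omega> in M. Z \<omega> = 0"
      for Z :: "'a \<Rightarrow> 'b"
      using integral_nonneg_eq_0_iff_AE[of M "\<lambda>\<omega>. (norm (Z \<omega>))\<^sup>2"]
      by (simp add: square_integrable_def antisym)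
    from True have "AE \<omega> in M. X \<omega> \<bullet> Y \<omega> = 0"
      using zero[of X] zero[of Y] assms by auto
    then have "(\<integral>\<omega>. X \<omega> \<bullet> Y \<omega> \<partial>M) = 0"
      by (simp add: integral_eq_zero_AE)
    then show ?thesis using True by auto
  qed
qed

text \<open>Coordinatewise, the known factor \<open>h\<close> is pulled out of the conditional
  expectation. Integrability of the product with \<open>r\<close> is inherited from the product with
  \<open>g\<close>.\<close>

lemma (in prob_space) integral_inner_cond_exp:
  fixes g h r :: "'a \<Rightarrow> real^'d"
  assumes subalg: "subalgebra M N"
    and cond: "\<And>j. AE \<omega> in M. real_cond_exp M N (\<lambda>\<omega>. g \<omega> $ j) \<omega> = r \<omega> $ j"
    and g: "square_integrable M g" and h: "square_integrable M h"
    and h_N: "h \<in> borel_measurable N" and [measurable]: "r \<in> borel_measurable M"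
  shows "integrable M (\<lambda>\<omega>. r \<omega> \<bullet> h \<omega>)"
    and "(\<integral>\<omega>. r \<omega> \<bullet> h \<omega> \<partial>M) = (\<integral>\<omega>. g \<omega> \<bullet> h \<omega> \<partial>M)"
proof -
  interpret N: finite_measure_subalgebra M N by unfold_locales (rule subalg)
  note [measurable] = square_integrable_measurable[OF g] square_integrable_measurable[OF h]
  have comp [measurable]: "(\<lambda>\<omega>. X \<omega> $ j) \<in> borel_measurable K"
    if "X \<in> borel_measurable K" for X :: "'a \<Rightarrow> real^'d" and K j
    using borel_measurable_inner[OF that borel_measurable_const[of "axis j 1"]]
    by (simp add: inner_axis)
  have prod: "integrable M (\<lambda>\<omega>. h \<omega> $ j * g \<omega> $ j)" for j
  proof (rule Bochner_Integration.integrable_bound)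
    show "integrable M (\<lambda>\<omega>. (norm (h \<omega>))\<^sup>2 + (norm (g \<omega>))\<^sup>2)"
      using g h by (auto simp: square_integrable_def)
    have "\<bar>h \<omega> $ j * g \<omega> $ j\<bar> \<le> (norm (h \<omega>))\<^sup>2 + (norm (g \<omega>))\<^sup>2" for \<omega>
    proof -
      have "\<bar>h \<omega> $ j * g \<omega> $ j\<bar> \<le> norm (h \<omega>) * norm (g \<omega>)"
        unfolding abs_mult by (intro mult_mono component_le_norm_cart) auto
      moreover have "2 * (norm (h \<omega>) * norm (g \<omega>)) \<le> (norm (h \<omega>))\<^sup>2 + (norm (g \<omega>))\<^sup>2"
        using sum_squares_bound[of "norm (h \<omega>)" "norm (g \<omega>)"] by (simp add: mult.assoc)
      moreover have "0 \<le> norm (h \<omega>) * norm (g \<omega>)" by simp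
      ultimately show ?thesis by linarith
    qed
    then show "AE \<omega> in M. norm (h \<omega> $ j * g \<omega> $ j) \<le> norm ((norm (h \<omega>))\<^sup>2 + (norm (g \<omega>))\<^sup>2)"
      by (intro AE_I2) (simp add: abs_of_nonneg)
  qed measurable
  have coord: "integrable M (\<lambda>\<omega>. h \<omega> $ j * r \<omega> $ j)"
    "(\<integral>\<omega>. h \<omega> $ j * r \<omega> $ j \<partial>M) = (\<integral>\<omega>. h \<omega> $ j * g \<omega> $ j \<partial>M)" for j
  proof -
    have ae: "AE \<omega> in M. h \<omega> $ j * real_cond_exp M N (\<lambda>\<omega>. g \<omega> $ j) \<omega> = h \<omega> $ j * r \<omega> $ j"
      using cond[of j] by eventually_elim simp
    note ce = N.real_cond_exp_intg[OF prod[of j] comp[OF h_N], OF comp[OF square_integrable_measurable[OF g]]]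
    have [measurable]: "real_cond_exp M N (\<lambda>\<omega>. g \<omega> $ j) \<in> borel_measurable M"
      by simp
    show "integrable M (\<lambda>\<omega>. h \<omega> $ j * r \<omega> $ j)"
      using ce(1) integrable_cong_AE[OF _ _ ae] by simp
    show "(\<integral>\<omega>. h \<omega> $ j * r \<omega> $ j \<partial>M) = (\<integral>\<omega>. h \<omega> $ j * g \<omega> $ j \<partial>M)"
      using ce(2) integral_cong_AE[OF _ _ ae] by simp
  qed
  show "integrable M (\<lambda>\<omega>. r \<omega> \<bullet> h \<omega>)"
    using coord(1) by (simp add: inner_vec_def mult.commute)
  show "(\<integral>\<omega>. r \<omega> \<bullet> h \<omega> \<partial>M) = (\<integral>\<omega>. g \<omega> \<bullet> h \<omega> \<partial>M)"
    using coord prod by (simp add: inner_vec_def mult.commute Bochner_Integration.integral_sum)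
qed

section \<open>Measurability of the M-DSGD states\<close>

lemma borel_measurable_vec_times [measurable (raw)]:
  fixes f g :: "'a \<Rightarrow> real^'d"
  assumes "f \<in> borel_measurable M" "g \<in> borel_measurable M"
  shows "(\<lambda>x. f x * g x) \<in> borel_measurable M"
proof (rule borel_measurable_continuous_Pair[OF assms])
  show "continuous_on UNIV (\<lambda>x :: (real^'d) \<times> (real^'d). fst x * snd x)"
    unfolding times_vec_def by (intro continuous_intros)
qed

text \<open>A sum over a random multiset becomes a sum over a fixed finite set with random
  coefficients, to which closure of measurability under finite sums applies.\<close>

lemma sum_mset_eq_sum_count:
  fixes g :: "'b \<Rightarrow> 'a::real_vector"
  assumes "finite A" "set_mset X \<subseteq> A"
  shows "(\<Sum>i\<in>#X. g i) = (\<Sum>i\<in>A. real (count X i) *\<^sub>R g i)"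
  using assms(2)
proof (induction X)
  case empty
  then show ?case by simp
next
  case (add a X)
  have "(\<Sum>i\<in>A. real (count (add_mset a X) i) *\<^sub>R g i)
      = (\<Sum>i\<in>A. real (count X i) *\<^sub>R g i + (if i = a then g i else 0))"
    by (intro sum.cong) (auto simp: algebra_simps)
  also have "\<dots> = (\<Sum>i\<in>#X. g i) + g a"
    using add assms(1) by (simp add: sum.distrib sum.delta)
  finally show ?case by (simp add: add.commute)
qed

lemma borel_measurable_sum_mset:
  fixes g :: "'b \<Rightarrow> 'a \<Rightarrow> 'c::{second_countable_topology, real_normed_vector}"
  assumes "finite A" and X: "X \<in> M \<rightarrow>\<^sub>M count_space UNIV"
    and "\<And>\<omega>. \<omega> \<in> space M \<Longrightarrow> set_mset (X \<omega>) \<subseteq> A"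
    and g: "\<And>i. i \<in> A \<Longrightarrow> g i \<in> borel_measurable M"
  shows "(\<lambda>\<omega>. \<Sum>i\<in>#X \<omega>. g i \<omega>) \<in> borel_measurable M"
proof -
  have "(\<lambda>\<omega>. \<Sum>i\<in>A. real (count (X \<omega>) i) *\<^sub>R g i \<omega>) \<in> borel_measurable M"
  proof (intro borel_measurable_sum borel_measurable_scaleR g)
    fix i
    show "(\<lambda>\<omega>. real (count (X \<omega>) i)) \<in> borel_measurable M"
      using measurable_compose[OF X, of "\<lambda>Y. real (count Y i)" borel] by simp
  qed
  then show ?thesis
    using assms(1,3) by (simp add: sum_mset_eq_sum_count cong: measurable_cong)
qed

text \<open>Iterate, momenta and memories feed into each other, so one induction treats them
  together, worker by worker. The point \<open>x\<close> is random because it is both the start and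
  the regularisation centre of a stage.\<close>

lemma mdsgd_state_measurable:
  fixes df :: "nat \<Rightarrow> real^'d \<Rightarrow> real^'d" and x :: "'a \<Rightarrow> real^'d" and p b :: nat and \<gamma> \<eta> \<beta> :: real
    and I :: "nat \<Rightarrow> nat \<Rightarrow> 'a \<Rightarrow> nat multiset" and m :: "nat \<Rightarrow> nat \<Rightarrow> 'a \<Rightarrow> real^'d"
  defines "st \<equiv> \<lambda>t \<omega>. mdsgd_state p b (regularised_grad \<gamma> df (x \<omega>)) (x \<omega>) \<eta> \<beta>
    (\<lambda>t k. I t k \<omega>) (\<lambda>t k. m t k \<omega>) t"
  assumes x [measurable]: "x \<in> borel_measurable M"
    and df: "\<And>i. i \<in> {1..n} \<Longrightarrow> df i \<in> borel_measurable borel"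
    and I: "\<And>t k. t < T \<Longrightarrow> k \<in> {1..p} \<Longrightarrow> I t k \<in> M \<rightarrow>\<^sub>M count_space UNIV"
    and I_sub: "\<And>t k \<omega>. t < T \<Longrightarrow> k \<in> {1..p} \<Longrightarrow> \<omega> \<in> space M \<Longrightarrow> set_mset (I t k \<omega>) \<subseteq> {1..n}"
    and m: "\<And>t k. t < T \<Longrightarrow> k \<in> {1..p} \<Longrightarrow> m t k \<in> borel_measurable M"
    and "t \<le> T"
  shows "(\<lambda>\<omega>. fst (st t \<omega>)) \<in> borel_measurable M \<and>
    (\<forall>k\<in>{1..p}. (\<lambda>\<omega>. fst (snd (st t \<omega>)) k) \<in> borel_measurable M \<and>
      (\<lambda>\<omega>. snd (snd (st t \<omega>)) k) \<in> borel_measurable M)"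
  using \<open>t \<le> T\<close>
proof (induction t)
  case 0
  show ?case using x by (simp add: st_def)
next
  case (Suc t)
  then have t: "t < T" by simp
  define w g u where "w = (\<lambda>\<omega>. fst (st t \<omega>))" and "g = (\<lambda>k \<omega>. fst (snd (st t \<omega>)) k)"
    and "u = (\<lambda>k \<omega>. snd (snd (st t \<omega>)) k)"
  have w [measurable]: "w \<in> borel_measurable M"
    and gu [measurable]: "\<And>k. k \<in> {1..p} \<Longrightarrow> g k \<in> borel_measurable M"
      "\<And>k. k \<in> {1..p} \<Longrightarrow> u k \<in> borel_measurable M"
    using Suc by (auto simp: w_def g_def u_def)
  define g' where "g' = (\<lambda>k \<omega>. \<beta> *\<^sub>R g k \<omega>
    + worker_grad p b (regularised_grad \<gamma> df (x \<omega>)) (I t k \<omega>) (w \<omega>))"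
  have wg: "(\<lambda>\<omega>. worker_grad p b (regularised_grad \<gamma> df (x \<omega>)) (I t k \<omega>) (w \<omega>))
      \<in> borel_measurable M" if "k \<in> {1..p}" for k
    unfolding worker_grad_def regularised_grad_def
  proof (intro borel_measurable_scaleR borel_measurable_const)
    show "(\<lambda>\<omega>. \<Sum>i\<in>#I t k \<omega>. df i (w \<omega>) + (1 / \<gamma>) *\<^sub>R (w \<omega> - x \<omega>)) \<in> borel_measurable M"
    proof (rule borel_measurable_sum_mset[of "{1..n}"])
      fix i assume "i \<in> {1..n}"
      note [measurable] = df[OF this]
      show "(\<lambda>\<omega>. df i (w \<omega>) + (1 / \<gamma>) *\<^sub>R (w \<omega> - x \<omega>)) \<in> borel_measurable M"
        by measurable
    qed (use I[OF t that] I_sub[OF t that] in auto)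
  qed
  have g' [measurable]: "g' k \<in> borel_measurable M" if "k \<in> {1..p}" for k
    unfolding g'_def using wg[OF that] gu(1)[OF that] by measurable
  have Suc_eq: "st (Suc t) \<omega> = (w \<omega> - \<eta> *\<^sub>R (\<Sum>k=1..p. m t k \<omega> * (g' k \<omega> + u k \<omega>)),
      \<lambda>k. g' k \<omega>, \<lambda>k. (1 - m t k \<omega>) * (g' k \<omega> + u k \<omega>))" for \<omega>
    by (simp add: st_def w_def g_def u_def g'_def split_beta Let_def)
  have prod: "(\<lambda>\<omega>. m t k \<omega> * (g' k \<omega> + u k \<omega>)) \<in> borel_measurable M"
    "(\<lambda>\<omega>. (1 - m t k \<omega>) * (g' k \<omega> + u k \<omega>)) \<in> borel_measurable M" if "k \<in> {1..p}" for k
    using m[OF t that] g'[OF that] gu(2)[OF that] by measurable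
  have "(\<lambda>\<omega>. \<Sum>k=1..p. m t k \<omega> * (g' k \<omega> + u k \<omega>)) \<in> borel_measurable M"
    by (intro borel_measurable_sum prod)
  then have "(\<lambda>\<omega>. w \<omega> - \<eta> *\<^sub>R (\<Sum>k=1..p. m t k \<omega> * (g' k \<omega> + u k \<omega>))) \<in> borel_measurable M"
    by measurable
  then show ?case
    unfolding Suc_eq using g' prod(2) by auto
qed

section \<open>One stage\<close>

text \<open>The sequences \<open>w\<close> and \<open>u\<close> are parameters tied to the algorithm
  by equations, so that the stage sequences of the theorem can be inserted directly. The
  conditioning variable contains \<open>x\<close>, on which the comparison point
  \<open>prox_point\<close> depends.\<close>

locale mdsgd_stage = prob_space P + weakly_convex F F' c \<gamma> L
  for P :: "'s measure" and F :: "real^'d \<Rightarrow> real" and F' :: "real^'d \<Rightarrow> real^'d" and c \<gamma> L :: real +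
  fixes n p b T :: nat and df :: "nat \<Rightarrow> real^'d \<Rightarrow> real^'d" and x :: "'s \<Rightarrow> real^'d"
    and \<eta> \<beta> G B U :: real
    and I :: "nat \<Rightarrow> nat \<Rightarrow> 's \<Rightarrow> nat multiset" and m :: "nat \<Rightarrow> nat \<Rightarrow> 's \<Rightarrow> real^'d"
    and w u :: "nat \<Rightarrow> 's \<Rightarrow> real^'d" and wstar :: "real^'d"
  assumes gamma: "\<gamma> = 1 / (2 * c)"
    and pos: "p \<ge> 1" "b \<ge> 1" "T > 0" "\<eta> > 0"
    and beta: "0 \<le> \<beta>" "\<beta> < 1"
    and w_eq: "w t \<omega> = fst (mdsgd_state p b (regularised_grad \<gamma> df (x \<omega>)) (x \<omega>) \<eta> \<beta>
          (\<lambda>t k. I t k \<omega>) (\<lambda>t k. m t k \<omega>) t)"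
    and u_eq: "u t \<omega> = (\<Sum>k=1..p. snd (snd (mdsgd_state p b (regularised_grad \<gamma> df (x \<omega>)) (x \<omega>)
          \<eta> \<beta> (\<lambda>t k. I t k \<omega>) (\<lambda>t k. m t k \<omega>) t)) k)"
    and x_measurable [measurable]: "x \<in> borel_measurable P"
    and F'_measurable [measurable]: "F' \<in> borel_measurable borel"
    and df_measurable: "i \<in> {1..n} \<Longrightarrow> df i \<in> borel_measurable borel"
    and batch_measurable: "t < T \<Longrightarrow> k \<in> {1..p} \<Longrightarrow> I t k \<in> P \<rightarrow>\<^sub>M count_space UNIV"
    and batch: "t < T \<Longrightarrow> k \<in> {1..p} \<Longrightarrow> \<omega> \<in> space P \<Longrightarrow>
          set_mset (I t k \<omega>) \<subseteq> {1..n} \<and> size (I t k \<omega>) = b"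
    and mask_measurable: "t < T \<Longrightarrow> k \<in> {1..p} \<Longrightarrow> m t k \<in> borel_measurable P"
    and stochastic_gradient: "t < T \<Longrightarrow>
          bounded_stochastic_gradient P G F' (\<lambda>\<omega>. (x \<omega>, w t \<omega>)) (w t)
            (\<lambda>\<omega>. aggregated_grad p b df (\<lambda>k. I t k \<omega>) (w t \<omega>))"
    and minimizer: "F wstar \<le> F z"
    and w_bound: "t < T \<Longrightarrow> expectation_le P (\<lambda>\<omega>. (norm (w t \<omega> - wstar))\<^sup>2) (B\<^sup>2)"
    and u_bound: "t < T \<Longrightarrow> expectation_le P (\<lambda>\<omega>. (norm (u t \<omega>))\<^sup>2) (U\<^sup>2)"
begin

definition prox_point :: "'s \<Rightarrow> real^'d"
  where "prox_point \<omega> = prox \<gamma> F (x \<omega>)"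

definition stage_grad :: "nat \<Rightarrow> 's \<Rightarrow> real^'d"
  where "stage_grad t \<omega> = aggregated_grad p b df (\<lambda>k. I t k \<omega>) (w t \<omega>) + (1 / \<gamma>) *\<^sub>R (w t \<omega> - x \<omega>)"

definition momentum :: "nat \<Rightarrow> 's \<Rightarrow> real^'d"
  where "momentum t \<omega> = (\<Sum>k=1..p. fst (snd (mdsgd_state p b (regularised_grad \<gamma> df (x \<omega>)) (x \<omega>)
          \<eta> \<beta> (\<lambda>t k. I t k \<omega>) (\<lambda>t k. m t k \<omega>) t)) k)"

definition drift :: "nat \<Rightarrow> 's \<Rightarrow> real^'d"
  where "drift t \<omega> = u t \<omega> + (\<beta> / (1 - \<beta>)) *\<^sub>R momentum t \<omega>"

definition Ghat :: real
  where "Ghat = sqrt (2 * G\<^sup>2 + 4 * B\<^sup>2 / \<gamma>\<^sup>2)"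

definition Vhat :: real
  where "Vhat = sqrt (2 * Ghat\<^sup>2 * \<beta>\<^sup>2 / (1 - \<beta>) ^ 4 + 2 * U\<^sup>2)"

lemma Ghat_sq: "0 \<le> Ghat" "Ghat\<^sup>2 = 2 * G\<^sup>2 + 4 * B\<^sup>2 / \<gamma>\<^sup>2"
  by (simp_all add: Ghat_def)

lemma Vhat_sq: "0 \<le> Vhat" "Vhat\<^sup>2 = 2 * Ghat\<^sup>2 * \<beta>\<^sup>2 / (1 - \<beta>) ^ 4 + 2 * U\<^sup>2"
  by (simp_all add: Vhat_def)

lemma w_0: "w 0 = x"
  by (simp add: w_eq fun_eq_iff)

lemma states_measurable:
  assumes "t \<le> T"
  shows "w t \<in> borel_measurable P" "u t \<in> borel_measurable P" "momentum t \<in> borel_measurable P"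
proof -
  note * = mdsgd_state_measurable[where df = df and x = x and M = P and n = n and T = T and t = t
      and p = p and b = b and I = I and m = m and \<gamma> = \<gamma> and \<eta> = \<eta> and \<beta> = \<beta>,
      OF x_measurable df_measurable batch_measurable _ mask_measurable assms]
  show "w t \<in> borel_measurable P" "u t \<in> borel_measurable P" "momentum t \<in> borel_measurable P"
    using * batch unfolding w_eq[abs_def] u_eq[abs_def] momentum_def[abs_def]
    by (auto intro!: borel_measurable_sum)
qed

lemma stage_grad_eq:
  assumes "t < T" "\<omega> \<in> space P"
  shows "stage_grad t \<omega> = aggregated_grad p b (regularised_grad \<gamma> df (x \<omega>)) (\<lambda>k. I t k \<omega>) (w t \<omega>)"
  unfolding stage_grad_def using pos batch[OF assms(1) _ assms(2)]
  by (subst aggregated_grad_regularised) auto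

text \<open>The deterministic recursions are instantiated at a single sample point. Identifying the
  batch gradient with \<open>stage_grad\<close> uses the exact batch size, hence the restriction to
  times below \<open>T\<close>.\<close>

lemma path:
  assumes "\<omega> \<in> space P"
  shows regret_path: "2 * (\<eta> / (1 - \<beta>)) * (\<Sum>t<T. stage_grad t \<omega> \<bullet> (w t \<omega> - z)) \<le> (norm (x \<omega> - z))\<^sup>2
      + (\<Sum>t<T. 2 * (\<eta> / (1 - \<beta>)) * \<eta> * (stage_grad t \<omega> \<bullet> drift t \<omega>) + (\<eta> / (1 - \<beta>))\<^sup>2 * (norm (stage_grad t \<omega>))\<^sup>2)"
    and momentum_0: "momentum 0 \<omega> = 0"
    and norm_momentum_Suc: "t < T \<Longrightarrow> (norm (momentum (Suc t) \<omega>))\<^sup>2 \<le> \<beta> * (norm (momentum t \<omega>))\<^sup>2 + (norm (stage_grad t \<omega>))\<^sup>2 / (1 - \<beta>)"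
proof -
  interpret path: mdsgd p b "regularised_grad \<gamma> df (x \<omega>)" "x \<omega>" \<eta> \<beta> "\<lambda>t k. I t k \<omega>" "\<lambda>t k. m t k \<omega>"
    by unfold_locales (fact beta)+
  have eqs: "path.iterate t = w t \<omega>" "path.memory t = u t \<omega>" "path.momentum t = momentum t \<omega>"
    "path.drift t = drift t \<omega>" for t
    by (simp_all add: path.iterate_def path.memory_def path.momentum_def path.drift_def
        w_eq u_eq momentum_def drift_def)
  have a: "path.batch_grad t = stage_grad t \<omega>" if "t < T" for t
    using stage_grad_eq[OF that assms] by (simp add: path.batch_grad_def eqs)
  show "2 * (\<eta> / (1 - \<beta>)) * (\<Sum>t<T. stage_grad t \<omega> \<bullet> (w t \<omega> - z)) \<le> (norm (x \<omega> - z))\<^sup>2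
      + (\<Sum>t<T. 2 * (\<eta> / (1 - \<beta>)) * \<eta> * (stage_grad t \<omega> \<bullet> drift t \<omega>) + (\<eta> / (1 - \<beta>))\<^sup>2 * (norm (stage_grad t \<omega>))\<^sup>2)"
    using path.regret[of z T] by (simp add: eqs a)
  show "momentum 0 \<omega> = 0"
    using path.initial(2) by (simp add: eqs)
  show "(norm (momentum (Suc t) \<omega>))\<^sup>2 \<le> \<beta> * (norm (momentum t \<omega>))\<^sup>2 + (norm (stage_grad t \<omega>))\<^sup>2 / (1 - \<beta>)" if "t < T"
    using path.norm_momentum_Suc[of t] by (simp add: eqs a[OF that])
qed

section \<open>Second moments within a stage\<close>

lemma square_integrable_w_diff_wstar:
  assumes "t < T"
  shows "square_integrable P (\<lambda>\<omega>. w t \<omega> - wstar)"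
    and "(\<integral>\<omega>. (norm (w t \<omega> - wstar))\<^sup>2 \<partial>P) \<le> B\<^sup>2"
proof -
  have [measurable]: "w t \<in> borel_measurable P"
    using states_measurable(1) assms by simp
  show "square_integrable P (\<lambda>\<omega>. w t \<omega> - wstar)" "(\<integral>\<omega>. (norm (w t \<omega> - wstar))\<^sup>2 \<partial>P) \<le> B\<^sup>2"
    using w_bound[OF assms] by (simp_all add: expectation_le_def square_integrable_def)
qed

text \<open>The stage point is the iterate at time 0, so both points lie within B of
  \<open>wstar\<close> in mean square; doubling both bounds gives the factor 4.\<close>

lemma square_integrable_w_diff_x:
  assumes "t < T"
  shows "square_integrable P (\<lambda>\<omega>. w t \<omega> - x \<omega>)"
    and "(\<integral>\<omega>. (norm (w t \<omega> - x \<omega>))\<^sup>2 \<partial>P) \<le> 4 * B\<^sup>2"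
proof -
  note w = square_integrable_w_diff_wstar[OF assms]
  note x = square_integrable_w_diff_wstar[OF pos(3), unfolded w_0]
  show "square_integrable P (\<lambda>\<omega>. w t \<omega> - x \<omega>)" "(\<integral>\<omega>. (norm (w t \<omega> - x \<omega>))\<^sup>2 \<partial>P) \<le> 4 * B\<^sup>2"
    using square_integrable_add[OF w(1) square_integrable_minus_commute[OF x(1)]] w(2) x(2)
    by (simp_all add: norm_minus_commute[of wstar])
qed

lemma prox_point_measurable [measurable]: "prox_point \<in> borel_measurable P"
  unfolding prox_point_def[abs_def]
  by (rule borel_measurable_continuous_on[OF continuous_prox x_measurable])

text \<open>The detour through \<open>wstar\<close>, a fixed point of the prox map, reduces the
  claim to the moment bound at time 0.\<close>

lemma square_integrable_x_diff_prox_point: "square_integrable P (\<lambda>\<omega>. x \<omega> - prox_point \<omega>)"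
proof -
  note x = square_integrable_w_diff_wstar(1)[OF pos(3), unfolded w_0]
  define K where "K = 1 / (1 - c * \<gamma>)"
  have "square_integrable P (\<lambda>\<omega>. prox_point \<omega> - wstar)"
  proof (rule square_integrable_dominated)
    show "integrable P (\<lambda>\<omega>. K\<^sup>2 * (norm (x \<omega> - wstar))\<^sup>2)"
      using square_integrable_integrable[OF x] by simp
    fix \<omega>
    have "norm (prox_point \<omega> - wstar) \<le> K * norm (x \<omega> - wstar)"
      using prox_lipschitz[of "x \<omega>" wstar] prox_minimizer[of wstar] minimizer
      by (simp add: prox_point_def K_def)
    from power_mono[OF this norm_ge_zero, of 2]
    show "(norm (prox_point \<omega> - wstar))\<^sup>2 \<le> K\<^sup>2 * (norm (x \<omega> - wstar))\<^sup>2"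
      by (simp add: power_mult_distrib)
  qed measurable
  from square_integrable_add(1)[OF x square_integrable_minus_commute[OF this]] show ?thesis
    by simp
qed

lemma square_integrable_w_diff_prox_point:
  assumes "t < T"
  shows "square_integrable P (\<lambda>\<omega>. w t \<omega> - prox_point \<omega>)"
  using square_integrable_add(1)[OF square_integrable_w_diff_x(1)[OF assms] square_integrable_x_diff_prox_point]
  by simp

lemma square_integrable_aggregated_grad:
  assumes "t < T"
  shows "square_integrable P (\<lambda>\<omega>. aggregated_grad p b df (\<lambda>k. I t k \<omega>) (w t \<omega>))"
    and "(\<integral>\<omega>. (norm (aggregated_grad p b df (\<lambda>k. I t k \<omega>) (w t \<omega>)))\<^sup>2 \<partial>P) \<le> G\<^sup>2"
proof -
  have w: "w t \<in> borel_measurable P"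
    using states_measurable(1) assms by simp
  have "(\<lambda>\<omega>. aggregated_grad p b df (\<lambda>k. I t k \<omega>) (w t \<omega>)) \<in> borel_measurable P"
    unfolding aggregated_grad_def worker_grad_def
  proof (intro borel_measurable_sum borel_measurable_scaleR borel_measurable_const)
    fix k assume k: "k \<in> {1..p}"
    show "(\<lambda>\<omega>. \<Sum>i\<in>#I t k \<omega>. df i (w t \<omega>)) \<in> borel_measurable P"
      by (rule borel_measurable_sum_mset[of "{1..n}"])
        (use batch[OF assms k] batch_measurable[OF assms k] measurable_compose[OF w df_measurable] in auto)
  qed
  then show "square_integrable P (\<lambda>\<omega>. aggregated_grad p b df (\<lambda>k. I t k \<omega>) (w t \<omega>))"
    "(\<integral>\<omega>. (norm (aggregated_grad p b df (\<lambda>k. I t k \<omega>) (w t \<omega>)))\<^sup>2 \<partial>P) \<le> G\<^sup>2"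
    using stochastic_gradient[OF assms]
    by (simp_all add: bounded_stochastic_gradient_def expectation_le_def square_integrable_def)
qed

text \<open>
  The cross term only allows the bound \<open>2 G\<^sup>2 + 8 B\<^sup>2 / \<gamma>\<^sup>2\<close>, which may exceed \<open>Ghat\<^sup>2\<close>; the factor 2 is
  absorbed by the slack in the factor 3 in front of \<open>Chat\<close>.
\<close>

lemma square_integrable_stage_grad:
  assumes "t < T"
  shows "square_integrable P (stage_grad t)" and "(\<integral>\<omega>. (norm (stage_grad t \<omega>))\<^sup>2 \<partial>P) \<le> 2 * Ghat\<^sup>2"
proof -
  note g = square_integrable_aggregated_grad[OF assms]
  note r = square_integrable_w_diff_x[OF assms]
  note s = square_integrable_scaleR[OF r(1), of "1 / \<gamma>"]
  show "square_integrable P (stage_grad t)"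
    using square_integrable_add(1)[OF g(1) s(1)] by (simp add: stage_grad_def[abs_def])
  have "(\<integral>\<omega>. (norm (stage_grad t \<omega>))\<^sup>2 \<partial>P) \<le> 2 * G\<^sup>2 + 2 * ((1 / \<gamma>)\<^sup>2 * (4 * B\<^sup>2))"
    using square_integrable_add(2)[OF g(1) s(1)] g(2) mult_left_mono[OF r(2), of "(1 / \<gamma>)\<^sup>2"]
    unfolding stage_grad_def s(2) by simp
  also have "\<dots> \<le> 2 * Ghat\<^sup>2"
    unfolding Ghat_sq(2) by (simp add: power_divide)
  finally show "(\<integral>\<omega>. (norm (stage_grad t \<omega>))\<^sup>2 \<partial>P) \<le> 2 * Ghat\<^sup>2" .
qed

lemma square_integrable_momentum:
  assumes "t \<le> T"
  shows "square_integrable P (momentum t) \<and> (\<integral>\<omega>. (norm (momentum t \<omega>))\<^sup>2 \<partial>P) \<le> 2 * Ghat\<^sup>2 / (1 - \<beta>)\<^sup>2"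
  using assms
proof (induction t)
  case 0
  have "square_integrable P (momentum 0)"
    by (rule square_integrable_dominated[where b = "\<lambda>_. 0"]) (auto simp: momentum_0 states_measurable)
  moreover have "(\<integral>\<omega>. (norm (momentum 0 \<omega>))\<^sup>2 \<partial>P) = 0"
    by (simp add: momentum_0 cong: Bochner_Integration.integral_cong)
  ultimately show ?case by simp
next
  case (Suc t)
  then have t: "t < T" and IH: "square_integrable P (momentum t)"
    "(\<integral>\<omega>. (norm (momentum t \<omega>))\<^sup>2 \<partial>P) \<le> 2 * Ghat\<^sup>2 / (1 - \<beta>)\<^sup>2" by auto
  note a = square_integrable_stage_grad[OF t]
  have int: "integrable P (\<lambda>\<omega>. \<beta> * (norm (momentum t \<omega>))\<^sup>2 + (norm (stage_grad t \<omega>))\<^sup>2 / (1 - \<beta>))"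
    using square_integrable_integrable[OF IH(1)] square_integrable_integrable[OF a(1)] by simp
  have v: "square_integrable P (momentum (Suc t))"
    using states_measurable(3)[OF Suc.prems] int norm_momentum_Suc[OF _ t] by (rule square_integrable_dominated)
  have "(\<integral>\<omega>. (norm (momentum (Suc t) \<omega>))\<^sup>2 \<partial>P)
      \<le> (\<integral>\<omega>. \<beta> * (norm (momentum t \<omega>))\<^sup>2 + (norm (stage_grad t \<omega>))\<^sup>2 / (1 - \<beta>) \<partial>P)"
    by (intro integral_mono int square_integrable_integrable[OF v] norm_momentum_Suc[OF _ t])
  also have "\<dots> = \<beta> * (\<integral>\<omega>. (norm (momentum t \<omega>))\<^sup>2 \<partial>P) + (\<integral>\<omega>. (norm (stage_grad t \<omega>))\<^sup>2 \<partial>P) / (1 - \<beta>)"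
    using square_integrable_integrable[OF IH(1)] square_integrable_integrable[OF a(1)] by simp
  also have "\<dots> \<le> \<beta> * (2 * Ghat\<^sup>2 / (1 - \<beta>)\<^sup>2) + 2 * Ghat\<^sup>2 / (1 - \<beta>)"
    using IH(2) a(2) beta by (intro add_mono mult_left_mono divide_right_mono) auto
  \<comment> \<open>The bound is a fixed point of the recursion, so it does not deteriorate with the
    number of iterations.\<close>
  also have "\<dots> = 2 * Ghat\<^sup>2 / (1 - \<beta>)\<^sup>2"
  proof -
    define e where "e = 1 - \<beta>"
    have "e \<noteq> 0" "\<beta> + e = 1" using beta by (auto simp: e_def)
    have "\<beta> * (2 * Ghat\<^sup>2 / e\<^sup>2) + 2 * Ghat\<^sup>2 / e = (\<beta> + e) * (2 * Ghat\<^sup>2) / e\<^sup>2"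
      using \<open>e \<noteq> 0\<close> by (simp add: field_simps power2_eq_square)
    then show ?thesis unfolding \<open>\<beta> + e = 1\<close> by (simp add: e_def)
  qed
  finally show ?case using v by simp
qed

text \<open>The momentum inherits the factor 2 of the bound on \<open>stage_grad\<close>; this
  produces the factor 2 in front of \<open>Vhat\<close> squared, and the memory term fits with room
  to spare.\<close>

lemma square_integrable_drift:
  assumes "t < T"
  shows "square_integrable P (drift t)" and "(\<integral>\<omega>. (norm (drift t \<omega>))\<^sup>2 \<partial>P) \<le> 2 * Vhat\<^sup>2"
proof -
  have v: "square_integrable P (momentum t)" "(\<integral>\<omega>. (norm (momentum t \<omega>))\<^sup>2 \<partial>P) \<le> 2 * Ghat\<^sup>2 / (1 - \<beta>)\<^sup>2"
    using square_integrable_momentum[of t] assms by auto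
  have u: "square_integrable P (u t)" "(\<integral>\<omega>. (norm (u t \<omega>))\<^sup>2 \<partial>P) \<le> U\<^sup>2"
    using u_bound[OF assms] states_measurable(2)[of t] assms
    by (simp_all add: expectation_le_def square_integrable_def)
  define r where "r = \<beta> / (1 - \<beta>)"
  note s = square_integrable_scaleR[OF v(1), of r]
  show "square_integrable P (drift t)"
    using square_integrable_add(1)[OF u(1) s(1)] by (simp add: drift_def[abs_def] r_def)
  have "(\<integral>\<omega>. (norm (drift t \<omega>))\<^sup>2 \<partial>P) \<le> 2 * U\<^sup>2 + 2 * (r\<^sup>2 * (2 * Ghat\<^sup>2 / (1 - \<beta>)\<^sup>2))"
    using square_integrable_add(2)[OF u(1) s(1)] u(2) mult_left_mono[OF v(2), of "r\<^sup>2"]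
    unfolding drift_def s(2) r_def[symmetric] by simp
  also have "r\<^sup>2 * (2 * Ghat\<^sup>2 / (1 - \<beta>)\<^sup>2) = 2 * Ghat\<^sup>2 * \<beta>\<^sup>2 / (1 - \<beta>) ^ 4"
    using beta by (simp add: r_def field_simps power2_eq_square power4_eq_xxxx)
  also have "2 * U\<^sup>2 + 2 * (2 * Ghat\<^sup>2 * \<beta>\<^sup>2 / (1 - \<beta>) ^ 4) \<le> 2 * Vhat\<^sup>2"
    unfolding Vhat_sq(2) by simp
  finally show "(\<integral>\<omega>. (norm (drift t \<omega>))\<^sup>2 \<partial>P) \<le> 2 * Vhat\<^sup>2" .
qed

text \<open>The drift carries the history of the stage and need not be a function of
  \<open>x\<close> and \<open>w t\<close>, so unbiasedness cannot simplify this expectation. Each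
  factor brings one square root of 2.\<close>

lemma stage_grad_inner_drift_le: "(\<integral>\<omega>. stage_grad t \<omega> \<bullet> drift t \<omega> \<partial>P) \<le> 2 * (Ghat * Vhat)" if t: "t < T"
proof -
  have "(\<integral>\<omega>. stage_grad t \<omega> \<bullet> drift t \<omega> \<partial>P) \<le> sqrt 2 * Ghat * (sqrt 2 * Vhat)"
    using square_integrable_Cauchy_Schwarz[OF square_integrable_stage_grad(1) square_integrable_drift(1),
      of t t "sqrt 2 * Ghat" "sqrt 2 * Vhat"]
    square_integrable_stage_grad(2)[of t] square_integrable_drift(2)[of t] Ghat_sq(1) Vhat_sq(1) t
    by (simp add: power_mult_distrib)
  also have "\<dots> = 2 * (Ghat * Vhat)"
    by (metis mult.assoc mult.left_commute real_sqrt_mult_self abs_numeral)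
  finally show ?thesis .
qed

section \<open>Unbiasedness and expected descent\<close>

lemma unbiased:
  assumes "t < T"
  defines "q \<equiv> \<lambda>\<omega>. (F' (w t \<omega>) + (1 / \<gamma>) *\<^sub>R (w t \<omega> - x \<omega>)) \<bullet> (w t \<omega> - prox_point \<omega>)"
  shows "integrable P q" and "(\<integral>\<omega>. q \<omega> \<partial>P) = (\<integral>\<omega>. stage_grad t \<omega> \<bullet> (w t \<omega> - prox_point \<omega>) \<partial>P)"
proof -
  \<comment> \<open>Relative to this sigma-algebra \<open>w t - prox_point\<close> is known, by
    continuity of the prox map. The regularising term is the same vector on both sides of the claim,
    so only the loss gradient needs the conditional expectation.\<close>
  define N where "N = vimage_algebra (space P) (\<lambda>\<omega>. (x \<omega>, w t \<omega>)) (borel :: ((real^'d) \<times> (real^'d)) measure)"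
  have [measurable]: "w t \<in> borel_measurable P"
    using states_measurable(1) assms by simp
  have "(\<lambda>\<omega>. (x \<omega>, w t \<omega>)) \<in> borel_measurable P" by measurable
  then have N: "subalgebra P N"
    unfolding subalgebra_def N_def by (simp add: sets_image_in_sets)
  have xw: "(\<lambda>\<omega>. (x \<omega>, w t \<omega>)) \<in> borel_measurable N"
    unfolding N_def by (rule measurable_vimage_algebra1) simp
  have h: "(\<lambda>\<omega>. w t \<omega> - prox_point \<omega>) \<in> borel_measurable N"
  proof -
    have "continuous_on UNIV (\<lambda>z. snd z - prox \<gamma> F (fst z))"
      by (intro continuous_intros continuous_on_compose2[OF continuous_prox]) auto
    from borel_measurable_continuous_on[OF this xw] show ?thesis by (simp add: prox_point_def)
  qed
  note g = square_integrable_aggregated_grad(1)[OF assms(1)]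
  note wy = square_integrable_w_diff_prox_point[OF assms(1)]
  note wx = square_integrable_scaleR(1)[OF square_integrable_w_diff_x(1)[OF assms(1)], of "1 / \<gamma>"]
  have cond: "AE \<omega> in P. real_cond_exp P N
      (\<lambda>\<omega>. aggregated_grad p b df (\<lambda>k. I t k \<omega>) (w t \<omega>) $ j) \<omega> = F' (w t \<omega>) $ j" for j
    using stochastic_gradient[OF assms(1)] by (simp add: bounded_stochastic_gradient_def N_def)
  have "(\<lambda>\<omega>. F' (w t \<omega>)) \<in> borel_measurable P" by measurable
  note ce = integral_inner_cond_exp[OF N cond g wy h this]
  note inner = square_integrable_inner[OF g wy] square_integrable_inner[OF wx wy]
  show "integrable P q" "(\<integral>\<omega>. q \<omega> \<partial>P) = (\<integral>\<omega>. stage_grad t \<omega> \<bullet> (w t \<omega> - prox_point \<omega>) \<partial>P)"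
    using ce inner unfolding q_def stage_grad_def inner_add_left by simp_all
qed

lemma stage_descent:
  defines "D \<equiv> (\<integral>\<omega>. (norm (x \<omega> - prox_point \<omega>))\<^sup>2 \<partial>P)"
    and "Chat \<equiv> Ghat * Vhat + Ghat\<^sup>2 / (2 - 2 * \<beta>)"
  assumes F_x: "integrable P (\<lambda>\<omega>. F (x \<omega>))"
    and F_out: "integrable P (\<lambda>\<omega>. F ((1 / real T) *\<^sub>R (\<Sum>t<T. w t \<omega>)))"
  shows "(\<integral>\<omega>. F ((1 / real T) *\<^sub>R (\<Sum>t<T. w t \<omega>)) \<partial>P) + c * D
    \<le> (\<integral>\<omega>. F (x \<omega>) \<partial>P) + 3 / 2 * ((1 - \<beta>) / (2 * \<eta> * real T) * D + 2 * Chat * \<eta>)"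
proof -
  define \<kappa> where "\<kappa> = \<eta> / (1 - \<beta>)"
  define q where "q = (\<lambda>t \<omega>. (F' (w t \<omega>) + (1 / \<gamma>) *\<^sub>R (w t \<omega> - x \<omega>)) \<bullet> (w t \<omega> - prox_point \<omega>))"
  define Q where "Q = (\<Sum>t<T. (\<integral>\<omega>. q t \<omega> \<partial>P))"
  have kappa: "0 < \<kappa>" using pos beta by (simp add: \<kappa>_def)
  have q: "integrable P (q t)" "(\<integral>\<omega>. q t \<omega> \<partial>P) = (\<integral>\<omega>. stage_grad t \<omega> \<bullet> (w t \<omega> - prox_point \<omega>) \<partial>P)" if "t < T" for t
    using unbiased[OF that] by (simp_all add: q_def)
  have q_sum: "integrable P (\<lambda>\<omega>. \<Sum>t<T. q t \<omega>)" "(\<integral>\<omega>. (\<Sum>t<T. q t \<omega>) \<partial>P) = Q"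
    unfolding Q_def using q(1)
    by (auto intro!: Bochner_Integration.integrable_sum Bochner_Integration.integral_sum)
  have D_int: "integrable P (\<lambda>\<omega>. (norm (x \<omega> - prox_point \<omega>))\<^sup>2)"
    by (rule square_integrable_integrable[OF square_integrable_x_diff_prox_point])
  have a_w: "integrable P (\<lambda>\<omega>. stage_grad t \<omega> \<bullet> (w t \<omega> - prox_point \<omega>))" if "t < T" for t
    using that by (intro square_integrable_inner square_integrable_stage_grad(1) square_integrable_w_diff_prox_point)
  have a_d: "integrable P (\<lambda>\<omega>. stage_grad t \<omega> \<bullet> drift t \<omega>)" if "t < T" for t
    using that by (intro square_integrable_inner square_integrable_stage_grad(1) square_integrable_drift)
  have a_a: "integrable P (\<lambda>\<omega>. (norm (stage_grad t \<omega>))\<^sup>2)" if "t < T" for t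
    using that by (intro square_integrable_integrable square_integrable_stage_grad(1))
  define r where "r = (\<lambda>t \<omega>. 2 * \<kappa> * \<eta> * (stage_grad t \<omega> \<bullet> drift t \<omega>) + \<kappa>\<^sup>2 * (norm (stage_grad t \<omega>))\<^sup>2)"
  have r: "integrable P (r t)"
    "(\<integral>\<omega>. r t \<omega> \<partial>P) = 2 * \<kappa> * \<eta> * (\<integral>\<omega>. stage_grad t \<omega> \<bullet> drift t \<omega> \<partial>P) + \<kappa>\<^sup>2 * (\<integral>\<omega>. (norm (stage_grad t \<omega>))\<^sup>2 \<partial>P)"
    if "t < T" for t
    unfolding r_def using a_d[OF that] a_a[OF that] by simp_all
  have r_sum: "integrable P (\<lambda>\<omega>. \<Sum>t<T. r t \<omega>)" "(\<integral>\<omega>. (\<Sum>t<T. r t \<omega>) \<partial>P) = (\<Sum>t<T. (\<integral>\<omega>. r t \<omega> \<partial>P))"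
    using r(1) by (auto intro!: Bochner_Integration.integrable_sum Bochner_Integration.integral_sum)
  have "(\<integral>\<omega>. (\<Sum>t<T. stage_grad t \<omega> \<bullet> (w t \<omega> - prox_point \<omega>)) \<partial>P) = Q"
    unfolding Q_def by (subst Bochner_Integration.integral_sum) (auto simp: a_w q(2))
  then have "2 * \<kappa> * Q = (\<integral>\<omega>. 2 * \<kappa> * (\<Sum>t<T. stage_grad t \<omega> \<bullet> (w t \<omega> - prox_point \<omega>)) \<partial>P)"
    by simp
  also have "\<dots> \<le> (\<integral>\<omega>. (norm (x \<omega> - prox_point \<omega>))\<^sup>2
      + (\<Sum>t<T. r t \<omega>) \<partial>P)"
  proof (rule integral_mono)
    show "integrable P (\<lambda>\<omega>. 2 * \<kappa> * (\<Sum>t<T. stage_grad t \<omega> \<bullet> (w t \<omega> - prox_point \<omega>)))"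
      by (intro integrable_mult_right Bochner_Integration.integrable_sum a_w) simp
    show "integrable P (\<lambda>\<omega>. (norm (x \<omega> - prox_point \<omega>))\<^sup>2
        + (\<Sum>t<T. r t \<omega>))"
      by (intro Bochner_Integration.integrable_add D_int r_sum)
  qed (unfold \<kappa>_def r_def, rule regret_path)
  also have "\<dots> = D + (\<Sum>t<T. 2 * \<kappa> * \<eta> * (\<integral>\<omega>. stage_grad t \<omega> \<bullet> drift t \<omega> \<partial>P) + \<kappa>\<^sup>2 * (\<integral>\<omega>. (norm (stage_grad t \<omega>))\<^sup>2 \<partial>P))"
    unfolding D_def using D_int r r_sum by simp
  also have "\<dots> \<le> D + (\<Sum>t<T. 2 * \<kappa> * \<eta> * (2 * (Ghat * Vhat)) + \<kappa>\<^sup>2 * (2 * Ghat\<^sup>2))"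
    using kappa pos by (intro add_left_mono sum_mono add_mono mult_left_mono stage_grad_inner_drift_le square_integrable_stage_grad(2)) auto
  also have "\<dots> = D + 2 * \<kappa> * (real T * (\<eta> * (2 * (Ghat * Vhat)) + \<kappa> * Ghat\<^sup>2))"
    by (simp add: algebra_simps power2_eq_square)
  \<comment> \<open>Both noise contributions are brought to a common factor \<eta>, with a 2 in
    front of each summand of \<open>Chat\<close>.\<close>
  also have "\<kappa> * Ghat\<^sup>2 = \<eta> * (2 * (Ghat\<^sup>2 / (2 - 2 * \<beta>)))"
    using beta by (simp add: \<kappa>_def field_simps)
  also have "\<eta> * (2 * (Ghat * Vhat)) + \<eta> * (2 * (Ghat\<^sup>2 / (2 - 2 * \<beta>))) = 2 * Chat * \<eta>"
    by (simp add: Chat_def algebra_simps)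
  finally have "2 * \<kappa> * (Q - real T * (2 * Chat * \<eta>)) \<le> D" by (simp add: algebra_simps)
  then have "Q - real T * (2 * Chat * \<eta>) \<le> D / (2 * \<kappa>)"
    using kappa by (simp add: field_simps)
  also have "\<dots> = (1 - \<beta>) / (2 * \<eta>) * D"
    using pos beta by (simp add: \<kappa>_def)
  finally have "(1 / real T) * Q \<le> (1 / real T) * ((1 - \<beta>) / (2 * \<eta>) * D + real T * (2 * Chat * \<eta>))"
    by (intro mult_left_mono) auto
  also have "\<dots> = (1 - \<beta>) / (2 * \<eta> * real T) * D + 2 * Chat * \<eta>"
    using pos by (simp add: distrib_left)
  finally have Q: "(1 / real T) * Q \<le> (1 - \<beta>) / (2 * \<eta> * real T) * D + 2 * Chat * \<eta>" .
  have "(\<integral>\<omega>. F ((1 / real T) *\<^sub>R (\<Sum>t<T. w t \<omega>)) + c * (norm (x \<omega> - prox_point \<omega>))\<^sup>2 \<partial>P)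
      \<le> (\<integral>\<omega>. F (x \<omega>) + 3 / 2 * ((1 / real T) * (\<Sum>t<T. q t \<omega>)) \<partial>P)"
  proof (rule integral_mono)
    show "integrable P (\<lambda>\<omega>. F ((1 / real T) *\<^sub>R (\<Sum>t<T. w t \<omega>)) + c * (norm (x \<omega> - prox_point \<omega>))\<^sup>2)"
      "integrable P (\<lambda>\<omega>. F (x \<omega>) + 3 / 2 * ((1 / real T) * (\<Sum>t<T. q t \<omega>)))"
      by (intro Bochner_Integration.integrable_add integrable_mult_right F_x F_out D_int q_sum)+
  qed (unfold prox_point_def q_def, rule average_descent[OF gamma pos(3)])
  also have "\<dots> = (\<integral>\<omega>. F (x \<omega>) \<partial>P) + 3 / 2 * ((1 / real T) * Q)"
    using F_x q_sum by simp
  also have "\<dots> \<le> (\<integral>\<omega>. F (x \<omega>) \<partial>P) + 3 / 2 * ((1 - \<beta>) / (2 * \<eta> * real T) * D + 2 * Chat * \<eta>)"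
    by (intro add_left_mono mult_left_mono Q) simp
  finally show ?thesis
    using F_out D_int by (simp add: D_def)
qed

end

section \<open>Combining the stages\<close>

text \<open>By Cauchy-Schwarz for finite sums, the mean-square bound on the sample gradients bounds
  the full gradient uniformly, as continuity of \<open>F\<close> requires.\<close>

lemma norm_average_le:
  fixes g :: "nat \<Rightarrow> 'a::real_normed_vector"
  assumes "n \<ge> 1" "0 \<le> K" "(1 / real n) * (\<Sum>i=1..n. (norm (g i))\<^sup>2) \<le> K\<^sup>2"
  shows "norm ((1 / real n) *\<^sub>R (\<Sum>i=1..n. g i)) \<le> K"
proof -
  have "(\<Sum>i=1..n. norm (g i))\<^sup>2 \<le> real n * (\<Sum>i=1..n. (norm (g i))\<^sup>2)"
    using sum_squared_le_sum_of_squares[of "\<lambda>i. norm (g i)" "{1..n}"] by (simp add: mult.commute)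
  also have "\<dots> \<le> real n * (real n * K\<^sup>2)"
    using assms(1,3) by (intro mult_left_mono) (auto simp: field_simps)
  finally have "(\<Sum>i=1..n. norm (g i))\<^sup>2 \<le> (real n * K)\<^sup>2"
    by (simp add: power2_eq_square ac_simps)
  then have "(\<Sum>i=1..n. norm (g i)) \<le> real n * K"
    by (rule power2_le_imp_le) (use assms in auto)
  then have "norm (\<Sum>i=1..n. g i) \<le> real n * K"
    using norm_sum[of g "{1..n}"] by linarith
  then show ?thesis using assms(1) by (simp add: field_simps)
qed

text \<open>Summation by parts: consecutive weights differ by 1, so every earlier value survives
  exactly once.\<close>

lemma sum_weighted_telescope:
  fixes e :: "nat \<Rightarrow> real"
  shows "(\<Sum>s<S. (real s + 1) * (e s - e (Suc s))) = (\<Sum>s<S. e s) - real S * e S"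
  by (induction S) (simp_all add: algebra_simps)

text \<open>Integrability belongs to the conclusion because the Bochner integral of a non-integrable
  function is 0, and the weighted sum would then say nothing about the expectation.\<close>

theorem theorem12:
  fixes P :: "'s measure"
    and f :: "nat \<Rightarrow> real^'d \<Rightarrow> real"
    and df :: "nat \<Rightarrow> real^'d \<Rightarrow> real^'d"
    and I :: "nat \<Rightarrow> nat \<Rightarrow> nat \<Rightarrow> 's \<Rightarrow> nat multiset"
    and m :: "nat \<Rightarrow> nat \<Rightarrow> nat \<Rightarrow> 's \<Rightarrow> real^'d"
    and T :: "nat \<Rightarrow> nat"
    and n p b S :: nat
    and w0 wstar :: "real^'d"
    and c G \<gamma> \<beta> \<eta>0 B U M :: real
  defines "F \<equiv> \<lambda>w. (1 / real n) * (\<Sum>i=1..n. f i w)"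
  defines "dF \<equiv> \<lambda>w. (1 / real n) *\<^sub>R (\<Sum>i=1..n. df i w)"
  defines "\<eta> \<equiv> \<lambda>s. \<eta>0 / (real s + 1)"
  defines "Ghat \<equiv> sqrt (2 * G\<^sup>2 + 4 * B\<^sup>2 / \<gamma>\<^sup>2)"
  defines "Chat \<equiv> Ghat * sqrt (2 * Ghat\<^sup>2 * \<beta>\<^sup>2 / (1 - \<beta>) ^ 4 + 2 * U\<^sup>2) + Ghat\<^sup>2 / (2 - 2 * \<beta>)"
  defines "wt \<equiv> \<lambda>s \<omega>. stage_point p b df \<gamma> w0 \<eta> \<beta> T
                (\<lambda>s t k. I s t k \<omega>) (\<lambda>s t k. m s t k \<omega>) s"
  defines "w \<equiv> \<lambda>s t \<omega>. stage_iterate p b df \<gamma> w0 \<eta> \<beta> T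
                (\<lambda>s t k. I s t k \<omega>) (\<lambda>s t k. m s t k \<omega>) s t"
  defines "u \<equiv> \<lambda>s t \<omega>. stage_memory p b df \<gamma> w0 \<eta> \<beta> T
                (\<lambda>s t k. I s t k \<omega>) (\<lambda>s t k. m s t k \<omega>) s t"
  assumes prob: "prob_space P"
    and pos: "n \<ge> 1" "p \<ge> 1" "b \<ge> 1" "S \<ge> 1" "c > 0" "G > 0" "\<eta>0 > 0"
    and beta: "0 \<le> \<beta>" "\<beta> < 1"
    and gamma: "\<gamma> = 1 / (2 * c)"
    and stage_length: "\<And>s. \<eta> s * real (T s) \<ge> 12 * \<gamma>"
    and df_gradient: "\<And>i. i \<in> {1..n} \<Longrightarrow> gradient_selection (f i) (df i)"
    and df_measurable: "\<And>i. i \<in> {1..n} \<Longrightarrow> df i \<in> borel_measurable borel"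
    and weak_convex: "weak_convex c F dF"
    and minimizer: "\<And>x. F wstar \<le> F x"
    and batch_measurable: "\<And>s t k. t < T s \<Longrightarrow> k \<in> {1..p} \<Longrightarrow>
          I s t k \<in> P \<rightarrow>\<^sub>M count_space UNIV"
    and batch: "\<And>s t k \<omega>. t < T s \<Longrightarrow> k \<in> {1..p} \<Longrightarrow> \<omega> \<in> space P \<Longrightarrow>
          set_mset (I s t k \<omega>) \<subseteq> {1..n} \<and> size (I s t k \<omega>) = b"
    and mask_measurable: "\<And>s t k. t < T s \<Longrightarrow> k \<in> {1..p} \<Longrightarrow> m s t k \<in> borel_measurable P"
    and mask: "\<And>s t k \<omega> j. t < T s \<Longrightarrow> k \<in> {1..p} \<Longrightarrow> \<omega> \<in> space P \<Longrightarrow>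
          m s t k \<omega> $ j \<in> {0, 1}"
    and sample_bound: "\<And>x. (1 / real n) * (\<Sum>i=1..n. (norm (df i x))\<^sup>2) \<le> G\<^sup>2"
    and stochastic_gradient: "\<And>s t. t < T s \<Longrightarrow>
          bounded_stochastic_gradient P G dF (\<lambda>\<omega>. (wt s \<omega>, w s t \<omega>)) (w s t)
            (\<lambda>\<omega>. aggregated_grad p b df (\<lambda>k. I s t k \<omega>) (w s t \<omega>))"
    and w_bound: "\<And>s t. t < T s \<Longrightarrow> expectation_le P (\<lambda>\<omega>. (norm (w s t \<omega> - wstar))\<^sup>2) (B\<^sup>2)"
    and u_bound: "\<And>s t. t < T s \<Longrightarrow> expectation_le P (\<lambda>\<omega>. (norm (u s t \<omega>))\<^sup>2) (U\<^sup>2)"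
    and F_bound: "\<And>s. expectation_le P (\<lambda>\<omega>. F (wt s \<omega>)) M"
  shows "(\<forall>s<S. integrable P (\<lambda>\<omega>. (norm (grad (moreau_envelope \<gamma> F) (wt s \<omega>)))\<^sup>2)) \<and>
    (1 + \<beta>) * \<gamma> / (4 * real S * (real S + 1)) *
      (\<Sum>s<S. (real s + 1) * (\<integral>\<omega>. (norm (grad (moreau_envelope \<gamma> F) (wt s \<omega>)))\<^sup>2 \<partial>P))
    \<le> (M - F wstar + 3 * Chat * \<eta>0) / (real S + 1)"
proof -
  interpret prob_space P by (rule prob)
  have gamma_pos: "0 < \<gamma>" and c_gamma: "c * \<gamma> = 1 / 2" "1 / \<gamma> = 2 * c"
    using gamma pos(5) by auto
  have dF_measurable: "dF \<in> borel_measurable borel"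
    unfolding dF_def by (intro borel_measurable_scaleR borel_measurable_const borel_measurable_sum df_measurable)
  have "norm (dF x) \<le> G" for x
    unfolding dF_def using pos sample_bound by (intro norm_average_le) auto
  then have F_cont: "continuous_on UNIV F"
    by (rule weak_convex_continuous[OF weak_convex])
  interpret weakly_convex F dF c \<gamma> "F wstar"
    using weak_convex F_cont minimizer gamma_pos c_gamma by unfold_locales auto
  have eta_pos: "0 < \<eta> s" for s
    using pos by (simp add: \<eta>_def)
  have T_pos: "0 < T s" for s
    using stage_length[of s] gamma_pos by (intro Nat.gr0I) auto
  have w_eq: "w s t \<omega> = fst (mdsgd_state p b (regularised_grad \<gamma> df (wt s \<omega>)) (wt s \<omega>) (\<eta> s) \<beta>
      (\<lambda>t k. I s t k \<omega>) (\<lambda>t k. m s t k \<omega>) t)" for s t \<omega>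
    by (simp add: w_def wt_def stage_iterate_def stage_state_def Let_def)
  have u_eq: "u s t \<omega> = (\<Sum>k=1..p. snd (snd (mdsgd_state p b (regularised_grad \<gamma> df (wt s \<omega>)) (wt s \<omega>) (\<eta> s) \<beta>
      (\<lambda>t k. I s t k \<omega>) (\<lambda>t k. m s t k \<omega>) t)) k)" for s t \<omega>
    by (simp add: u_def wt_def stage_memory_def stage_state_def Let_def)
  have wt_Suc: "wt (Suc s) \<omega> = (1 / real (T s)) *\<^sub>R (\<Sum>t<T s. w s t \<omega>)" for s \<omega>
    unfolding w_eq by (simp add: wt_def mdsgd_output_def Let_def)
  \<comment> \<open>Each stage needs a measurable starting point, which is the output of the stage
    before; hence an induction over stages.\<close>
  have wt_measurable: "wt s \<in> borel_measurable P" for s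
  proof (induction s)
    case 0
    show ?case by (simp add: wt_def)
  next
    case (Suc s)
    have "w s t \<in> borel_measurable P" if "t < T s" for t
    proof -
      have "t \<le> T s" using that by simp
      from mdsgd_state_measurable[where df = df and x = "wt s" and M = P and n = n and T = "T s"
          and t = t and p = p and b = b and I = "I s" and m = "m s" and \<gamma> = \<gamma> and \<eta> = "\<eta> s" and \<beta> = \<beta>,
          OF Suc df_measurable batch_measurable _ mask_measurable this]
      show ?thesis using batch unfolding w_eq[abs_def] by auto
    qed
    then show ?case
      unfolding wt_Suc[abs_def] by (intro borel_measurable_scaleR borel_measurable_const borel_measurable_sum) auto
  qed
  have stage: "mdsgd_stage P F dF c \<gamma> (F wstar) n p b (T s) df (wt s) (\<eta> s) \<beta> G B U (I s) (m s) (w s) (u s) wstar" for s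
    using gamma pos T_pos eta_pos beta w_eq u_eq wt_measurable dF_measurable df_measurable
      batch_measurable batch mask_measurable stochastic_gradient minimizer w_bound u_bound
    by unfold_locales auto
  define D where "D = (\<lambda>s. \<integral>\<omega>. (norm (wt s \<omega> - prox \<gamma> F (wt s \<omega>)))\<^sup>2 \<partial>P)"
  define N where "N = (\<lambda>s. \<integral>\<omega>. (norm (grad (moreau_envelope \<gamma> F) (wt s \<omega>)))\<^sup>2 \<partial>P)"
  define e where "e = (\<lambda>s. \<integral>\<omega>. F (wt s \<omega>) \<partial>P)"
  have F_int: "integrable P (\<lambda>\<omega>. F (wt s \<omega>))" and e_le: "e s \<le> M" for s
    using F_bound[of s] by (simp_all add: expectation_le_def e_def)
  have e_ge: "F wstar \<le> e s" for s
    unfolding e_def by (rule integral_ge_const[OF F_int]) (simp add: minimizer)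
  have grad_sq: "(norm (grad (moreau_envelope \<gamma> F) x))\<^sup>2 = (2 * c)\<^sup>2 * (norm (x - prox \<gamma> F x))\<^sup>2" for x
    unfolding grad_moreau_envelope c_gamma(2) by (simp add: power_mult_distrib)
  have D_int: "integrable P (\<lambda>\<omega>. (norm (wt s \<omega> - prox \<gamma> F (wt s \<omega>)))\<^sup>2)" for s
    using square_integrable_integrable[OF mdsgd_stage.square_integrable_x_diff_prox_point[OF stage[of s]]]
    by (simp add: mdsgd_stage.prox_point_def[OF stage])
  have grad_int: "integrable P (\<lambda>\<omega>. (norm (grad (moreau_envelope \<gamma> F) (wt s \<omega>)))\<^sup>2)" for s
    unfolding grad_sq using D_int by simp
  have N_eq: "N s = (2 * c)\<^sup>2 * D s" for s
    unfolding N_def D_def grad_sq by simp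
  have descent: "(1 + \<beta>) * \<gamma> / 4 * N s \<le> e s - e (Suc s) + 3 * Chat * \<eta> s" for s
  proof -
    interpret st: mdsgd_stage P F dF c \<gamma> "F wstar" n p b "T s" df "wt s" "\<eta> s" \<beta> G B U "I s" "m s" "w s" "u s" wstar
      by (rule stage)
    have "st.Ghat = Ghat" by (simp add: st.Ghat_def Ghat_def)
    then have Chat: "st.Ghat * st.Vhat + st.Ghat\<^sup>2 / (2 - 2 * \<beta>) = Chat"
      by (simp add: st.Vhat_def Chat_def)
    have desc: "e (Suc s) + c * D s
        \<le> e s + 3 / 2 * ((1 - \<beta>) / (2 * \<eta> s * real (T s)) * D s + 2 * Chat * \<eta> s)"
      using st.stage_descent[OF F_int] F_int[of "Suc s"]
      unfolding Chat wt_Suc e_def D_def st.prox_point_def by simp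
    have D_nonneg: "0 \<le> D s" by (simp add: D_def)
    have "12 * \<gamma> \<le> \<eta> s * real (T s)" by (rule stage_length)
    \<comment> \<open>Since \<open>1 / \<gamma>\<close> is \<open>2 * c\<close>, the constant 12
      gives \<open>(1 - \<beta>) * c / 12\<close>, and the factor 3/2 makes this one eighth of
      \<open>(1 - \<beta>) * c\<close>.\<close>
    then have "(1 - \<beta>) / (2 * (\<eta> s * real (T s))) \<le> (1 - \<beta>) / (2 * (12 * \<gamma>))"
      using gamma_pos beta by (intro divide_left_mono) auto
    also have "\<dots> = (1 - \<beta>) * c / 12"
      using pos(5) unfolding gamma by (simp add: field_simps)
    finally have q: "(1 - \<beta>) / (2 * \<eta> s * real (T s)) * D s \<le> (1 - \<beta>) * c / 12 * D s"
      using D_nonneg by (intro mult_right_mono) (auto simp: mult.assoc)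
    have "e (Suc s) + c * D s \<le> e s + 3 / 2 * ((1 - \<beta>) * c / 12 * D s + 2 * Chat * \<eta> s)"
      by (rule order_trans[OF desc]) (intro add_left_mono mult_left_mono add_right_mono q, simp)
    then have *: "(1 - (1 - \<beta>) / 8) * (c * D s) \<le> e s - e (Suc s) + 3 * Chat * \<eta> s"
      by (simp add: field_simps)
    have "(1 + \<beta>) * \<gamma> / 4 * N s = (1 + \<beta>) / 2 * (c * D s)"
      unfolding N_eq gamma using pos(5) by (simp add: field_simps power2_eq_square)
    \<comment> \<open>The difference of the two coefficients is 3(1-\<beta>)/8, which is
      positive.\<close>
    also have "\<dots> \<le> (1 - (1 - \<beta>) / 8) * (c * D s)"
      using beta pos(5) D_nonneg by (intro mult_right_mono) (auto simp: field_simps)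
    finally show ?thesis using * by (rule order_trans)
  qed
  have "(1 + \<beta>) * \<gamma> / 4 * (\<Sum>s<S. (real s + 1) * N s)
      = (\<Sum>s<S. (real s + 1) * ((1 + \<beta>) * \<gamma> / 4 * N s))"
    unfolding sum_distrib_left by (intro sum.cong) auto
  also have "\<dots> \<le> (\<Sum>s<S. (real s + 1) * (e s - e (Suc s) + 3 * Chat * \<eta> s))"
    by (intro sum_mono mult_left_mono descent) auto
  \<comment> \<open>The weight cancels the denominator of the learning rate, so every stage
    contributes the same noise term.\<close>
  also have "\<dots> = (\<Sum>s<S. (real s + 1) * (e s - e (Suc s)) + 3 * Chat * \<eta>0)"
    by (intro sum.cong) (auto simp: \<eta>_def distrib_left add_nonneg_eq_0_iff)
  also have "\<dots> = (\<Sum>s<S. e s) - real S * e S + real S * (3 * Chat * \<eta>0)"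
    by (simp add: sum.distrib sum_weighted_telescope)
  also have "\<dots> \<le> real S * M - real S * F wstar + real S * (3 * Chat * \<eta>0)"
    using sum_mono[of "{..<S}" e "\<lambda>_. M", OF e_le] mult_left_mono[OF e_ge, of "real S" S] by simp
  finally have "(1 + \<beta>) * \<gamma> / 4 * (\<Sum>s<S. (real s + 1) * N s) \<le> real S * (M - F wstar + 3 * Chat * \<eta>0)"
    by (simp add: algebra_simps)
  then have "(1 + \<beta>) * \<gamma> / 4 * (\<Sum>s<S. (real s + 1) * N s) / (real S * (real S + 1))
      \<le> real S * (M - F wstar + 3 * Chat * \<eta>0) / (real S * (real S + 1))"
    by (rule divide_right_mono) simp
  also have "\<dots> = (M - F wstar + 3 * Chat * \<eta>0) / (real S + 1)"
    using pos(4) by simp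
  finally have "(1 + \<beta>) * \<gamma> / (4 * real S * (real S + 1)) * (\<Sum>s<S. (real s + 1) * N s)
      \<le> (M - F wstar + 3 * Chat * \<eta>0) / (real S + 1)"
    by (simp add: mult.assoc)
  then show ?thesis
    using grad_int unfolding N_def by blast
qed

end
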